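(* Let $G$ be an ADE graph and $(A,\cdot,{}^* )$ a double triangle algebra of $G$, $A=End^{gr}(\mathcal E)$. Let $\Delta:A\to A\otimes A$ be the linear map given, for $\xi,\xi'\in\mathcal E_n$, by $$\Delta(\xi\otimes\xi')=\sum_{\xi_i}(\xi\otimes\xi_i)_{\mathcal E}\otimes(\xi_i\otimes\xi')_{\mathcal E},$$ where $\xi_i$ runs over the elementary paths of length $n$. Then: (1) for all fundamental representations $f,f'$, the tensor product representation is induced by $\Delta$, i.e. $(\Phi^f_{\alpha\alpha'}\otimes\Phi^{f'}_{\beta\beta'})(\Delta(\xi\otimes\xi'))=\sum_{\xi_i}\Phi^f_{\alpha\alpha'}(\xi\otimes\xi_i)\,\Phi^{f'}_{\beta\beta'}(\xi_i\otimes\xi')=\Phi^{f\otimes f'}_{\alpha\star\beta,\alpha'\star\beta'}(\xi\otimes\xi')$ (for composable $\alpha,\beta$ and composable $\alpha',\beta'$); (2) $\Delta$ is coassociative; (3) $\Delta$ is an algebra morphism, $\Delta(a\cdot b)=\Delta(a)\cdot\Delta(b)$ for all $a,b\in A$; (4) $\Delta((\xi\otimes\xi')^* )=\Delta(\xi\otimes\xi')^*$, where $(a\otimes b)^*=a^*\otimes b^*$.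
   Context: Graph and paths. $G$ is an ADE graph (simply laced Dynkin diagram) with adjacency matrix $M$; $\beta$ is the largest eigenvalue of $M$ and $\mu=(\mu_v)$ its Perron–Frobenius eigenvector, normalized so that its smallest component is $1$. An elementary path of length $n\ge 0$ is a sequence $\xi=(v_0,\dots,v_n)$ of vertices with consecutive vertices adjacent; $s(\xi)=v_0$, $r(\xi)=v_n$, $\#\xi=n$, and $\tilde\xi=(v_n,\dots,v_0)$ (extended linearly). $\mathcal P=\bigoplus_n\mathcal P_n$ is the complex vector space with basis the elementary paths, graded by length. Concatenation: $\xi\star\xi'=\delta_{r(\xi)s(\xi')}\,(v_0,\dots,v_n,v_1',\dots,v_m')$. For $k\ge1$ the operator $c_k$ kills paths of length $n\le k$ and for $n>k$ is given by $c_k(v_0,\dots,v_n)=\sqrt{\mu_{v_k}/\mu_{v_{k+1}}}\;\delta_{v_{k-1},v_{k+1}}\,(v_0,\dots,v_{k-1},v_{k+2},\dots,v_n)$. The space of essential paths is $\mathcal E=\bigcap_k\ker c_k=\bigoplus_n\mathcal E_n$, which is finite dimensional for ADE graphs. Endomorphisms. Using the symmetric bilinear form on $\mathcal P_n$ for which elementary paths are orthonormal, the duals of $\mathcal P_n$ and $\mathcal E_n$ are identified with $\mathcal P_n$ and $\mathcal E_n$, so $End^{gr}(\mathcal P)=\bigoplus_n\mathcal P_n\otimes\mathcal P_n$ and $End^{gr}(\mathcal E)=\bigoplus_n\mathcal E_n\otimes\mathcal E_n$. DTA. A double triangle algebra of $G$ is a finite-dimensional unital $C^*$-algebra $(A,\cdot,{}^*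 )$ with underlying vector space $A=End^{gr}(\mathcal E)$ (the product $\cdot$ is not composition of endomorphisms), together with a set of "fundamental" irreducible matrix $*$-representations $\Phi^f$ of $A$, whose matrix indices $\alpha,\beta$ are the length-one elementary paths, such that: (0) $\Phi^f_{\alpha\beta}(\xi\otimes\xi')=0$ unless $s(\alpha)=s(\xi)$, $r(\alpha)=s(\xi')$, $s(\beta)=r(\xi)$, $r(\beta)=r(\xi')$; and for $\#\xi=\#\xi'=0$, $\Phi^f_{\alpha\alpha}(\xi\otimes\xi')=\delta_{s(\alpha)\xi}\delta_{r(\alpha)\xi'}$. (iii) Concatenation: $\Phi^f_{\alpha\beta}((\xi_1\star\xi_2)\otimes(\xi_1'\star\xi_2'))=\Phi^f_{\alpha\gamma}(\xi_1\otimes\xi_1')\,\Phi^f_{\gamma\beta}(\xi_2\otimes\xi_2')$, where $\gamma$ is the edge from $r(\xi_1)$ to $r(\xi_1')$ (zero if there is none); this defines $\Phi^f$ on all of $End^{gr}(\mathcal P)$ from its values on paths of length $0$ and $1$. (i) Unitarity: for elementary paths $\xi,\lambda$ of length $n$, $\sum_{\alpha,\xi'}\overline{\Phi^f_{\alpha\beta}(\xi\otimes\xi')}\,\Phi^f_{\alpha\eta}(\lambda\otimes\xi')=\delta_{\beta\eta}\delta_{\xi\lambda}$ (sum over edges $\alpha$ and elementary $\xi'$ of length $n$). (ii) Reflection: for elementary $\xi,\xi'$ of equal length, with $c=\sqrt{\mu_{r(\xi)}\mu_{s(\xi')}/(\mu_{s(\xi)}\mu_{r(\xi')})}$, $\Phi^f_{\alpha\beta}(\xi\otimes\xi')=c\,\overline{\Phi^f_{\beta\alpha}(\tilde\xi\otimes\tilde\xi')}=c\,\overline{\Phi^f_{\tilde\alpha\tilde\beta}(\xi'\otimes\xi)}$.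 (4) Tensor products of representations are given by $\Phi^{f\otimes f'}_{\alpha\star\beta,\alpha'\star\beta'}(\xi\otimes\xi')=\sum_{\xi_i}\Phi^f_{\alpha\alpha'}(\xi\otimes\xi_i)\,\Phi^{f'}_{\beta\beta'}(\xi_i\otimes\xi')$ (sum over elementary paths $\xi_i$ of length $\#\xi$; iterated similarly); every irreducible representation of $A$ occurs in the decomposition of tensor products of fundamental ones. Irreps and cells. $x$ runs over the irreducible representations of $A$, realized as matrix $*$-representations $\Phi^x$. $\Phi^x$ is extended to $End^{gr}(\mathcal P)$ by bilinearity and, for elementary paths of length $n\ge1$ that are concatenations $\xi=e_1\star\dots\star e_n$, $\xi'=e_1'\star\dots\star e_n'$ of edges, by the matrix product $\Phi^x(\xi\otimes\xi')=\Phi^x(e_1\otimes e_1')\cdots\Phi^x(e_n\otimes e_n')$. The matrix units $E^x_{\eta\eta'}\in A$ are the elements with $\Phi^y_{\alpha\beta}(E^x_{\eta\eta'})=\delta_{xy}\delta_{\alpha\eta}\delta_{\beta\eta'}$. For $\xi\otimes\xi'\in End^{gr}(\mathcal P)$ put $(\xi\otimes\xi')_{\mathcal E}=\sum_{x,\alpha,\beta}\Phi^x_{\alpha\beta}(\xi\otimes\xi')\,E^x_{\alpha\beta}\in A$.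
   Formalization: In the definition of a DTA, tensor products of fundamental representations are required to be *-representations of A (otherwise (4) can fail), and unitarity (i) is required only for edges β, η composable with ξ, λ (read literally it contradicts (0)). *)

theory Defs
  imports "HOL-Analysis.Analysis" "HOL-Library.Function_Algebras"
begin

text \<open>
  A complex vector space with a distinguished basis indexed by a type is rendered by
  (finitely supported) coordinate functions; addition is pointwise.
\<close>

type_synonym 'p cvec = "'p \<Rightarrow> complex"

definition cscale :: "complex \<Rightarrow> 'p cvec \<Rightarrow> 'p cvec"  (infixr "*\<^sub>C" 75)
  where "c *\<^sub>C x = (\<lambda>p. c * x p)"

global_interpretation cvec: vector_space cscale
  by unfold_locales (auto simp: cscale_def fun_eq_iff algebra_simps)

definition clinear_on :: "'p cvec set \<Rightarrow> 'q cvec set \<Rightarrow> ('p cvec \<Rightarrow> 'q cvec) \<Rightarrow> bool"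
  where "clinear_on U W f \<longleftrightarrow>
    (\<forall>a\<in>U. f a \<in> W) \<and>
    (\<forall>a\<in>U. \<forall>b\<in>U. f (a + b) = f a + f b) \<and>
    (\<forall>c. \<forall>a\<in>U. f (c *\<^sub>C a) = c *\<^sub>C f a)"

definition basis_vec :: "'p \<Rightarrow> 'p cvec"
  where "basis_vec p = (\<lambda>q. if q = p then 1 else 0)"

text \<open>The linear functional whose value on the basis vector \<open>p\<close> is \<open>\<phi> p\<close>, for finitely supported \<open>x\<close>.\<close>

definition lin_ext :: "('p \<Rightarrow> complex) \<Rightarrow> 'p cvec \<Rightarrow> complex"
  where "lin_ext \<phi> x = (\<Sum>p | x p \<noteq> 0. x p * \<phi> p)"

definition tensor :: "'p cvec \<Rightarrow> 'q cvec \<Rightarrow> ('p \<times> 'q) cvec"  (infixr "\<otimes>\<^sub>v" 70)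
  where "x \<otimes>\<^sub>v y = (\<lambda>(p, q). x p * y q)"

definition tensor_space :: "'p cvec set \<Rightarrow> 'q cvec set \<Rightarrow> ('p \<times> 'q) cvec set"
  where "tensor_space U W = cvec.span {x \<otimes>\<^sub>v y | x y. x \<in> U \<and> y \<in> W}"

text \<open>
  The map on \<open>tensor_space U W\<close> induced by a biadditive balanced map \<open>B\<close> (bilinear, or conjugate
  linear in both arguments); for such \<open>B\<close> the value does not depend on the chosen decomposition.
\<close>

definition tensor_lift ::
    "'p cvec set \<Rightarrow> 'q cvec set \<Rightarrow> ('p cvec \<Rightarrow> 'q cvec \<Rightarrow> 'r cvec) \<Rightarrow> ('p \<times> 'q) cvec \<Rightarrow> 'r cvec"
  where "tensor_lift U W B t = (THE z. \<exists>(m::nat) a b.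
    (\<forall>i<m. a i \<in> U \<and> b i \<in> W) \<and> t = (\<Sum>i<m. a i \<otimes>\<^sub>v b i) \<and> z = (\<Sum>i<m. B (a i) (b i)))"

definition tensor_map ::
    "'p cvec set \<Rightarrow> 'q cvec set \<Rightarrow> ('p cvec \<Rightarrow> 'r cvec) \<Rightarrow> ('q cvec \<Rightarrow> 's cvec)
      \<Rightarrow> ('p \<times> 'q) cvec \<Rightarrow> ('r \<times> 's) cvec"
  where "tensor_map U W f g = tensor_lift U W (\<lambda>a b. f a \<otimes>\<^sub>v g b)"

definition tensor_mult ::
    "'p cvec set \<Rightarrow> ('p cvec \<Rightarrow> 'p cvec \<Rightarrow> 'p cvec) \<Rightarrow> ('p \<times> 'p) cvec \<Rightarrow> ('p \<times> 'p) cvec \<Rightarrow> ('p \<times> 'p) cvec"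
  where "tensor_mult A mul s t =
    tensor_lift A A (\<lambda>a b. tensor_lift A A (\<lambda>c d. mul a c \<otimes>\<^sub>v mul b d) t) s"

definition reassoc :: "('p \<times> ('q \<times> 'r)) cvec \<Rightarrow> (('p \<times> 'q) \<times> 'r) cvec"
  where "reassoc t = (\<lambda>((p, q), r). t (p, (q, r)))"

definition dynkin_chain :: "nat \<Rightarrow> nat \<Rightarrow> bool"
  where "dynkin_chain i j \<longleftrightarrow> j = Suc i \<or> i = Suc j"

text \<open>The chain \<open>0, \<dots>, n - 2\<close> together with a vertex \<open>n - 1\<close> attached to the vertex \<open>b\<close>.\<close>

definition dynkin_branched :: "nat \<Rightarrow> nat \<Rightarrow> nat \<Rightarrow> nat \<Rightarrow> bool"
  where "dynkin_branched n b i j \<longleftrightarrow>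
    (i < n - 1 \<and> j < n - 1 \<and> dynkin_chain i j) \<or> (i = b \<and> j = n - 1) \<or> (i = n - 1 \<and> j = b)"

inductive dynkin_diagram :: "nat \<Rightarrow> (nat \<Rightarrow> nat \<Rightarrow> bool) \<Rightarrow> bool" where
  type_A: "n \<ge> 1 \<Longrightarrow> dynkin_diagram n dynkin_chain"
| type_D: "n \<ge> 4 \<Longrightarrow> dynkin_diagram n (dynkin_branched n (n - 3))"
| type_E: "n \<in> {6, 7, 8} \<Longrightarrow> dynkin_diagram n (dynkin_branched n 2)"

text \<open>The vertex set of the graph is the whole finite type \<open>'v\<close>.\<close>

definition ADE_graph :: "('v::finite \<Rightarrow> 'v \<Rightarrow> bool) \<Rightarrow> bool"
  where "ADE_graph adj \<longleftrightarrow> (\<exists>D f. dynkin_diagram CARD('v) D \<and> bij_betw f {..<CARD('v)} UNIV \<and>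
    (\<forall>i<CARD('v). \<forall>j<CARD('v). adj (f i) (f j) \<longleftrightarrow> D i j))"

definition adjacency_matrix :: "('v::finite \<Rightarrow> 'v \<Rightarrow> bool) \<Rightarrow> real^'v^'v"
  where "adjacency_matrix adj = (\<chi> v w. if adj v w then 1 else 0)"

definition eigenvector :: "real^'v^'v \<Rightarrow> real \<Rightarrow> real^'v \<Rightarrow> bool"
  where "eigenvector M b x \<longleftrightarrow> x \<noteq> 0 \<and> M *v x = b *\<^sub>R x"

definition perron_frobenius_vector :: "('v::finite \<Rightarrow> 'v \<Rightarrow> bool) \<Rightarrow> real^'v \<Rightarrow> bool"
  where "perron_frobenius_vector adj \<mu> \<longleftrightarrow> (\<exists>\<beta>.
    eigenvector (adjacency_matrix adj) \<beta> \<mu> \<and>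
    (\<forall>b x. eigenvector (adjacency_matrix adj) b x \<longrightarrow> b \<le> \<beta>) \<and>
    Min (range (\<lambda>v. \<mu> $ v)) = 1)"

text \<open>
  The path \<open>(v\<^sub>0, \<dots>, v\<^sub>n)\<close> of length \<open>n\<close> is the list with these \<open>n + 1\<close> entries;
  thus \<open>s = hd\<close>, \<open>r = last\<close>, and reversal of paths is \<open>rev\<close>.
\<close>

definition paths :: "('v \<Rightarrow> 'v \<Rightarrow> bool) \<Rightarrow> nat \<Rightarrow> 'v list set"
  where "paths adj n = {p. length p = Suc n \<and> (\<forall>i<n. adj (p ! i) (p ! Suc i))}"

abbreviation edges :: "('v \<Rightarrow> 'v \<Rightarrow> bool) \<Rightarrow> 'v list set"
  where "edges adj \<equiv> paths adj 1"

text \<open>Concatenation, only meaningful when \<open>last p = hd q\<close>.\<close>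

definition concat_path :: "'v list \<Rightarrow> 'v list \<Rightarrow> 'v list"  (infixr "\<star>" 65)
  where "p \<star> q = p @ tl q"

definition path_space :: "('v \<Rightarrow> 'v \<Rightarrow> bool) \<Rightarrow> nat \<Rightarrow> 'v list cvec set"
  where "path_space adj n = {x. \<forall>p. x p \<noteq> 0 \<longrightarrow> p \<in> paths adj n}"

definition cap_basis :: "real^'v \<Rightarrow> nat \<Rightarrow> 'v list \<Rightarrow> 'v list cvec"
  where "cap_basis \<mu> k p =
    (if k < length p - 1 \<and> p ! (k - 1) = p ! (k + 1)
     then of_real (sqrt (\<mu> $ (p ! k) / \<mu> $ (p ! (k + 1)))) *\<^sub>C basis_vec (take k p @ drop (k + 2) p)
     else 0)"

text \<open>This is the operator \<open>c\<^sub>k\<close>; it is only meaningful for \<open>k \<ge> 1\<close>.\<close>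

definition cap :: "real^'v \<Rightarrow> nat \<Rightarrow> 'v list cvec \<Rightarrow> 'v list cvec"
  where "cap \<mu> k x = (\<lambda>q. lin_ext (\<lambda>p. cap_basis \<mu> k p q) x)"

definition essential :: "('v \<Rightarrow> 'v \<Rightarrow> bool) \<Rightarrow> real^'v \<Rightarrow> nat \<Rightarrow> 'v list cvec set"
  where "essential adj \<mu> n = {x \<in> path_space adj n. \<forall>k\<ge>1. cap \<mu> k x = 0}"

text \<open>
  Elements of the graded endomorphism space of all paths have coordinates indexed by pairs of
  elementary paths of equal length; the graded endomorphisms of essential paths are a subspace.
\<close>

type_synonym 'v bipath = "'v list \<times> 'v list"

definition EndE :: "('v \<Rightarrow> 'v \<Rightarrow> bool) \<Rightarrow> real^'v \<Rightarrow> 'v bipath cvec set"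
  where "EndE adj \<mu> =
    cvec.span {\<xi> \<otimes>\<^sub>v \<xi>' | \<xi> \<xi>' n. \<xi> \<in> essential adj \<mu> n \<and> \<xi>' \<in> essential adj \<mu> n}"

locale finite_dim_cstar_algebra =
  fixes A :: "'p cvec set"
    and mul :: "'p cvec \<Rightarrow> 'p cvec \<Rightarrow> 'p cvec"
    and one :: "'p cvec"
    and star :: "'p cvec \<Rightarrow> 'p cvec"
  assumes subspace: "cvec.subspace A"
    and finite_dim: "\<exists>B. finite B \<and> cvec.span B = A"
    and mult_linear_left: "b \<in> A \<Longrightarrow> clinear_on A A (\<lambda>a. mul a b)"
    and mult_linear_right: "a \<in> A \<Longrightarrow> clinear_on A A (\<lambda>b. mul a b)"
    and mult_assoc: "\<lbrakk>a \<in> A; b \<in> A; c \<in> A\<rbrakk> \<Longrightarrow> mul (mul a b) c = mul a (mul b c)"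
    and one_closed: "one \<in> A"
    and mult_one_left: "a \<in> A \<Longrightarrow> mul one a = a"
    and mult_one_right: "a \<in> A \<Longrightarrow> mul a one = a"
    and star_closed: "a \<in> A \<Longrightarrow> star a \<in> A"
    and star_add: "\<lbrakk>a \<in> A; b \<in> A\<rbrakk> \<Longrightarrow> star (a + b) = star a + star b"
    and star_scale: "a \<in> A \<Longrightarrow> star (z *\<^sub>C a) = cnj z *\<^sub>C star a"
    and star_mult: "\<lbrakk>a \<in> A; b \<in> A\<rbrakk> \<Longrightarrow> star (mul a b) = mul (star b) (star a)"
    and star_star: "a \<in> A \<Longrightarrow> star (star a) = a"
    and cstar_norm: "\<exists>N :: 'p cvec \<Rightarrow> real.
      (\<forall>a\<in>A. N a \<ge> 0 \<and> (N a = 0 \<longleftrightarrow> a = 0)) \<and>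
      (\<forall>a\<in>A. \<forall>b\<in>A. N (a + b) \<le> N a + N b) \<and>
      (\<forall>z. \<forall>a\<in>A. N (z *\<^sub>C a) = cmod z * N a) \<and>
      (\<forall>a\<in>A. \<forall>b\<in>A. N (mul a b) \<le> N a * N b) \<and>
      (\<forall>a\<in>A. N (mul (star a) a) = (N a)\<^sup>2) \<and>
      (\<forall>X. (\<forall>n::nat. X n \<in> A) \<and> (\<forall>e>0. \<exists>M. \<forall>m\<ge>M. \<forall>n\<ge>M. N (X m - X n) < e)
        \<longrightarrow> (\<exists>a\<in>A. (\<lambda>n. N (X n - a)) \<longlonglongrightarrow> 0))"

text \<open>
  A matrix representation with finite index set \<open>I\<close> is given by its coefficient functionals
  \<open>R \<alpha> \<beta>\<close> for \<open>\<alpha>, \<beta> \<in> I\<close>; only their values on \<open>A\<close> matter.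
\<close>

type_synonym ('i, 'p) coeffs = "'i \<Rightarrow> 'i \<Rightarrow> 'p cvec \<Rightarrow> complex"

definition matrix_rep ::
    "'p cvec set \<Rightarrow> ('p cvec \<Rightarrow> 'p cvec \<Rightarrow> 'p cvec) \<Rightarrow> 'p cvec \<Rightarrow> 'i set \<Rightarrow> ('i, 'p) coeffs \<Rightarrow> bool"
  where "matrix_rep A mul one I R \<longleftrightarrow> finite I \<and> (\<forall>\<alpha>\<in>I. \<forall>\<beta>\<in>I.
    (\<forall>a\<in>A. \<forall>b\<in>A. R \<alpha> \<beta> (a + b) = R \<alpha> \<beta> a + R \<alpha> \<beta> b) \<and>
    (\<forall>c. \<forall>a\<in>A. R \<alpha> \<beta> (c *\<^sub>C a) = c * R \<alpha> \<beta> a) \<and>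
    (\<forall>a\<in>A. \<forall>b\<in>A. R \<alpha> \<beta> (mul a b) = (\<Sum>\<gamma>\<in>I. R \<alpha> \<gamma> a * R \<gamma> \<beta> b)) \<and>
    R \<alpha> \<beta> one = of_bool (\<alpha> = \<beta>))"

definition matrix_star_rep ::
    "'p cvec set \<Rightarrow> ('p cvec \<Rightarrow> 'p cvec \<Rightarrow> 'p cvec) \<Rightarrow> 'p cvec \<Rightarrow> ('p cvec \<Rightarrow> 'p cvec)
      \<Rightarrow> 'i set \<Rightarrow> ('i, 'p) coeffs \<Rightarrow> bool"
  where "matrix_star_rep A mul one star I R \<longleftrightarrow> matrix_rep A mul one I R \<and>
    (\<forall>a\<in>A. \<forall>\<alpha>\<in>I. \<forall>\<beta>\<in>I. R \<alpha> \<beta> (star a) = cnj (R \<beta> \<alpha> a))"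

text \<open>Column vectors indexed by \<open>I\<close> are functions vanishing outside \<open>I\<close>.\<close>

definition irreducible_rep :: "'p cvec set \<Rightarrow> 'i set \<Rightarrow> ('i, 'p) coeffs \<Rightarrow> bool"
  where "irreducible_rep A I R \<longleftrightarrow> I \<noteq> {} \<and>
    (\<forall>W :: 'i cvec set. cvec.subspace W \<and> W \<subseteq> {w. \<forall>\<alpha>. \<alpha> \<notin> I \<longrightarrow> w \<alpha> = 0} \<and>
        (\<forall>a\<in>A. \<forall>w\<in>W. (\<lambda>\<alpha>. if \<alpha> \<in> I then \<Sum>\<beta>\<in>I. R \<alpha> \<beta> a * w \<beta> else 0) \<in> W)
      \<longrightarrow> W = {0} \<or> W = {w. \<forall>\<alpha>. \<alpha> \<notin> I \<longrightarrow> w \<alpha> = 0})"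

definition intertwiner ::
    "'p cvec set \<Rightarrow> 'i set \<Rightarrow> ('i, 'p) coeffs \<Rightarrow> 'j set \<Rightarrow> ('j, 'p) coeffs \<Rightarrow> ('j \<Rightarrow> 'i \<Rightarrow> complex) \<Rightarrow> bool"
  where "intertwiner A I R J S T \<longleftrightarrow> (\<forall>a\<in>A. \<forall>j\<in>J. \<forall>i\<in>I.
    (\<Sum>k\<in>I. T j k * R k i a) = (\<Sum>l\<in>J. S j l a * T l i))"

definition equivalent_reps ::
    "'p cvec set \<Rightarrow> 'i set \<Rightarrow> ('i, 'p) coeffs \<Rightarrow> 'j set \<Rightarrow> ('j, 'p) coeffs \<Rightarrow> bool"
  where "equivalent_reps A I R J S \<longleftrightarrow> (\<exists>T T'.
    intertwiner A I R J S T \<and> intertwiner A J S I R T' \<and>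
    (\<forall>i\<in>I. \<forall>k\<in>I. (\<Sum>j\<in>J. T' i j * T j k) = of_bool (i = k)) \<and>
    (\<forall>j\<in>J. \<forall>l\<in>J. (\<Sum>i\<in>I. T j i * T' i l) = of_bool (j = l)))"

text \<open>\<open>R\<close> is equivalent to a direct summand of \<open>S\<close>: it embeds with an equivariant retraction.\<close>

definition occurs_in ::
    "'p cvec set \<Rightarrow> 'i set \<Rightarrow> ('i, 'p) coeffs \<Rightarrow> 'j set \<Rightarrow> ('j, 'p) coeffs \<Rightarrow> bool"
  where "occurs_in A I R J S \<longleftrightarrow> (\<exists>T T'.
    intertwiner A I R J S T \<and> intertwiner A J S I R T' \<and>
    (\<forall>i\<in>I. \<forall>k\<in>I. (\<Sum>j\<in>J. T' i j * T j k) = of_bool (i = k)))"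

text \<open>
  A complete system of representatives \<open>R x\<close> (\<open>x \<in> X\<close>, index sets \<open>I x\<close>) of the equivalence classes
  of irreducible representations, realized as matrix *-representations. Indexing an arbitrary
  matrix representation by an initial segment of the naturals is no loss of generality.
\<close>

locale irrep_system =
  fixes A :: "'p cvec set"
    and mul :: "'p cvec \<Rightarrow> 'p cvec \<Rightarrow> 'p cvec"
    and one :: "'p cvec"
    and star :: "'p cvec \<Rightarrow> 'p cvec"
    and X :: "'x set"
    and I :: "'x \<Rightarrow> 'i set"
    and R :: "'x \<Rightarrow> ('i, 'p) coeffs"
  assumes finite_irreps: "finite X"
    and star_rep: "x \<in> X \<Longrightarrow> matrix_star_rep A mul one star (I x) (R x)"
    and irreducible: "x \<in> X \<Longrightarrow> irreducible_rep A (I x) (R x)"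
    and inequivalent: "\<lbrakk>x \<in> X; y \<in> X; x \<noteq> y\<rbrakk> \<Longrightarrow> \<not> equivalent_reps A (I x) (R x) (I y) (R y)"
    and complete: "\<And>(d::nat) S. \<lbrakk>matrix_rep A mul one {..<d} S; irreducible_rep A {..<d} S\<rbrakk>
      \<Longrightarrow> \<exists>x\<in>X. equivalent_reps A {..<d} S (I x) (R x)"

definition matrix_units ::
    "'p cvec set \<Rightarrow> 'x set \<Rightarrow> ('x \<Rightarrow> 'i set) \<Rightarrow> ('x \<Rightarrow> ('i, 'p) coeffs) \<Rightarrow> ('x \<Rightarrow> 'i \<Rightarrow> 'i \<Rightarrow> 'p cvec) \<Rightarrow> bool"
  where "matrix_units A X I R E \<longleftrightarrow> (\<forall>x\<in>X. \<forall>\<eta>\<in>I x. \<forall>\<eta>'\<in>I x. E x \<eta> \<eta>' \<in> A \<and>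
    (\<forall>y\<in>X. \<forall>\<alpha>\<in>I y. \<forall>\<beta>\<in>I y.
      R y \<alpha> \<beta> (E x \<eta> \<eta>') = of_bool (x = y \<and> \<alpha> = \<eta> \<and> \<beta> = \<eta>')))"

text \<open>
  Fundamental representations are given by the values \<open>\<phi> f \<alpha> \<beta> (\<xi>, \<xi>')\<close> on the basis of pairs of
  elementary paths of equal length, extended by \<^const>\<open>lin_ext\<close>. The following are the
  coefficients, on the same basis, of the tensor product of a nonempty list of fundamental
  representations; its matrix indices are the elementary paths of length \<open>length fs\<close>,
  whose first edge and remainder are given by \<open>take 2\<close> and \<open>tl\<close>.
\<close>

fun tensor_coeff ::
    "('v \<Rightarrow> 'v \<Rightarrow> bool) \<Rightarrow> ('f \<Rightarrow> 'v list \<Rightarrow> 'v list \<Rightarrow> 'v bipath \<Rightarrow> complex)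
      \<Rightarrow> 'f list \<Rightarrow> 'v list \<Rightarrow> 'v list \<Rightarrow> 'v bipath \<Rightarrow> complex"
  where
    "tensor_coeff adj \<phi> [] p p' b = 0"
  | "tensor_coeff adj \<phi> [f] p p' b = \<phi> f p p' b"
  | "tensor_coeff adj \<phi> (f # g # fs) p p' (\<xi>, \<xi>') =
      (\<Sum>\<zeta>\<in>paths adj (length \<xi> - 1).
        \<phi> f (take 2 p) (take 2 p') (\<xi>, \<zeta>) * tensor_coeff adj \<phi> (g # fs) (tl p) (tl p') (\<zeta>, \<xi>'))"

text \<open>
  In \<open>unitarity\<close> the edges \<open>\<beta>\<close>, \<open>\<eta>\<close> are those that can be concatenated to \<open>\<xi>\<close>, \<open>\<lambda>\<close>: by \<open>support\<close>
  the left-hand side vanishes for all other ones. Tensor products of fundamental representations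
  are *-representations of the C*-algebra, again by restriction to \<open>EndE adj \<mu>\<close>.
\<close>

locale double_triangle_algebra =
  finite_dim_cstar_algebra "EndE adj \<mu>" mul one star
  for adj :: "'v::finite \<Rightarrow> 'v \<Rightarrow> bool"
    and \<mu> :: "real^'v"
    and mul :: "'v bipath cvec \<Rightarrow> 'v bipath cvec \<Rightarrow> 'v bipath cvec"
    and one :: "'v bipath cvec"
    and star :: "'v bipath cvec \<Rightarrow> 'v bipath cvec" +
  fixes F :: "'f set"
    and \<phi> :: "'f \<Rightarrow> 'v list \<Rightarrow> 'v list \<Rightarrow> 'v bipath \<Rightarrow> complex"
  assumes fund_star_rep: "f \<in> F \<Longrightarrow>
      matrix_star_rep (EndE adj \<mu>) mul one star (edges adj) (\<lambda>\<alpha> \<beta>. lin_ext (\<phi> f \<alpha> \<beta>))"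
    and fund_irreducible: "f \<in> F \<Longrightarrow>
      irreducible_rep (EndE adj \<mu>) (edges adj) (\<lambda>\<alpha> \<beta>. lin_ext (\<phi> f \<alpha> \<beta>))"
    and support: "\<lbrakk>f \<in> F; \<alpha> \<in> edges adj; \<beta> \<in> edges adj; \<xi> \<in> paths adj n; \<xi>' \<in> paths adj n;
      \<not> (hd \<alpha> = hd \<xi> \<and> last \<alpha> = hd \<xi>' \<and> hd \<beta> = last \<xi> \<and> last \<beta> = last \<xi>')\<rbrakk>
      \<Longrightarrow> \<phi> f \<alpha> \<beta> (\<xi>, \<xi>') = 0"
    and length_zero: "\<lbrakk>f \<in> F; \<alpha> \<in> edges adj\<rbrakk>
      \<Longrightarrow> \<phi> f \<alpha> \<alpha> ([v], [w]) = of_bool (hd \<alpha> = v \<and> last \<alpha> = w)"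
    and concatenation: "\<lbrakk>f \<in> F; \<alpha> \<in> edges adj; \<beta> \<in> edges adj;
      \<xi>1 \<in> paths adj n; \<xi>1' \<in> paths adj n; \<xi>2 \<in> paths adj m; \<xi>2' \<in> paths adj m;
      last \<xi>1 = hd \<xi>2; last \<xi>1' = hd \<xi>2'\<rbrakk>
      \<Longrightarrow> \<phi> f \<alpha> \<beta> (\<xi>1 \<star> \<xi>2, \<xi>1' \<star> \<xi>2') =
        (if adj (last \<xi>1) (last \<xi>1')
         then \<phi> f \<alpha> [last \<xi>1, last \<xi>1'] (\<xi>1, \<xi>1') * \<phi> f [last \<xi>1, last \<xi>1'] \<beta> (\<xi>2, \<xi>2')
         else 0)"
    and unitarity: "\<lbrakk>f \<in> F; \<xi> \<in> paths adj n; lam \<in> paths adj n; \<beta> \<in> edges adj; \<eta> \<in> edges adj;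
      last \<xi> = hd \<beta>; last lam = hd \<eta>\<rbrakk>
      \<Longrightarrow> (\<Sum>\<alpha>\<in>edges adj. \<Sum>\<xi>'\<in>paths adj n. cnj (\<phi> f \<alpha> \<beta> (\<xi>, \<xi>')) * \<phi> f \<alpha> \<eta> (lam, \<xi>'))
        = of_bool (\<beta> = \<eta> \<and> \<xi> = lam)"
    and reflection: "\<lbrakk>f \<in> F; \<alpha> \<in> edges adj; \<beta> \<in> edges adj; \<xi> \<in> paths adj n; \<xi>' \<in> paths adj n;
      c = sqrt (\<mu> $ last \<xi> * \<mu> $ hd \<xi>' / (\<mu> $ hd \<xi> * \<mu> $ last \<xi>'))\<rbrakk>
      \<Longrightarrow> \<phi> f \<alpha> \<beta> (\<xi>, \<xi>') = of_real c * cnj (\<phi> f \<beta> \<alpha> (rev \<xi>, rev \<xi>')) \<and>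
        \<phi> f \<alpha> \<beta> (\<xi>, \<xi>') = of_real c * cnj (\<phi> f (rev \<alpha>) (rev \<beta>) (\<xi>', \<xi>))"
    and tensor_star_rep: "\<lbrakk>fs \<noteq> []; set fs \<subseteq> F\<rbrakk> \<Longrightarrow>
      matrix_star_rep (EndE adj \<mu>) mul one star (paths adj (length fs))
        (\<lambda>p p'. lin_ext (tensor_coeff adj \<phi> fs p p'))"
    and irreps_occur: "\<And>(d::nat) S.
      \<lbrakk>matrix_rep (EndE adj \<mu>) mul one {..<d} S; irreducible_rep (EndE adj \<mu>) {..<d} S\<rbrakk> \<Longrightarrow>
      \<exists>fs. fs \<noteq> [] \<and> set fs \<subseteq> F \<and>
        occurs_in (EndE adj \<mu>) {..<d} S
          (paths adj (length fs)) (\<lambda>p p'. lin_ext (tensor_coeff adj \<phi> fs p p'))"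

text \<open>
  Extension of a matrix representation to pairs of elementary paths of equal length, by matrix
  products of its values on pairs of edges. Pairs of paths of length at most one lie in the
  algebra already.
\<close>

fun path_ext ::
    "'i set \<Rightarrow> ('i, 'v bipath) coeffs \<Rightarrow> 'i \<Rightarrow> 'i \<Rightarrow> 'v bipath \<Rightarrow> complex"
  where
    "path_ext I R \<alpha> \<beta> (v # w # u # p, v' # w' # u' # p') =
      (\<Sum>\<gamma>\<in>I. R \<alpha> \<gamma> (basis_vec ([v, w], [v', w'])) * path_ext I R \<gamma> \<beta> (w # u # p, w' # u' # p'))"
  | "path_ext I R \<alpha> \<beta> b = R \<alpha> \<beta> (basis_vec b)"

text \<open>The element \<open>(t)\<^sub>\<E>\<close> for \<open>t\<close> in the graded endomorphisms of all paths.\<close>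

definition essential_part ::
    "'x set \<Rightarrow> ('x \<Rightarrow> 'i set) \<Rightarrow> ('x \<Rightarrow> ('i, 'v bipath) coeffs) \<Rightarrow> ('x \<Rightarrow> 'i \<Rightarrow> 'i \<Rightarrow> 'v bipath cvec)
      \<Rightarrow> 'v bipath cvec \<Rightarrow> 'v bipath cvec"
  where "essential_part X I R E t =
    (\<Sum>x\<in>X. \<Sum>\<alpha>\<in>I x. \<Sum>\<beta>\<in>I x. lin_ext (path_ext (I x) (R x) \<alpha> \<beta>) t *\<^sub>C E x \<alpha> \<beta>)"

end

theory Submission
  imports Defs
begin

text \<open>
  Write \<open>\<Phi>\<^sup>f\<^sup>s\<close> for the tensor product of a list \<open>fs\<close> of fundamental representations. These
  star representations jointly separate the points of \<open>A\<close>, since every irreducible representation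
  occurs in one of them; hence the products of their coefficients separate the points of
  \<open>A \<otimes> A\<close> and \<open>A \<otimes> A \<otimes> A\<close>. The essential part of a pair of paths is the product in \<open>A\<close> of
  its pairs of edges, so that \<open>\<Phi>\<^sup>f\<^sup>s\<close>, which is compatible with concatenation, takes the same value
  on \<open>t\<close> and on its essential part. It follows that
  \<open>(\<Phi>\<^sup>f\<^sup>s \<otimes> \<Phi>\<^sup>g\<^sup>s) \<circ> \<Delta>\<close> is \<open>\<Phi>\<^sup>f\<^sup>s\<^sup>@\<^sup>g\<^sup>s\<close> on composable matrix indices and \<open>0\<close> on all others.
  All claims about \<open>\<Delta>\<close> become associativity of concatenation, and the fact that
  \<open>\<Phi>\<^sup>f\<^sup>s\<^sup>@\<^sup>g\<^sup>s\<close> is a star representation.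
\<close>

section \<open>Coordinate vectors and functionals\<close>

text \<open>The obstacle: the essential part is defined through irreducible representations and
  matrix units, while tensor products are described only for lists of fundamental representations.
  Passing between the two by decomposing into irreducibles would bring in unknown intertwiners. A
  linear combination of products of edge pairs avoids them, since every representation evaluates it
  by multiplicativity alone. Lists serve as index because they are closed under append, whereas a
  tensor product of irreducible representations is in general reducible. Vanishing on non-composable
  indices matters as much as the value on composable ones: it cuts the sum over pairs of matrix
  indices, which a product in A \<otimes> A produces, down to the paths that index the appended
  list. Joint separation is obtained from minimal left ideals and the C*-identity instead of the
  structure theory of semisimple algebras.\<close>

definition fin_supp :: "'p cvec set"
  where "fin_supp = {x. finite {p. x p \<noteq> 0}}"

lemma sum_cvec_apply: "(\<Sum>i\<in>S. f i) p = (\<Sum>i\<in>S. (f i :: 'p cvec) p)"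
  by (induction S rule: infinite_finite_induct) auto

lemma cscale_apply: "(c *\<^sub>C x) p = c * x p"
  by (simp add: cscale_def)

text \<open>
  As default simplification rules, the library's pointwise rules are eta-contracted and would unfold
  every sum of vectors, hiding it from the vector space lemmas.
\<close>

declare plus_fun_apply [simp del] zero_fun_apply [simp del]

lemmas cvec_apply = plus_fun_apply zero_fun_apply cscale_apply sum_cvec_apply

lemma subspace_fin_supp: "cvec.subspace (fin_supp :: 'p cvec set)"
proof (rule cvec.subspaceI)
  fix x y :: "'p cvec" and c
  assume *: "x \<in> fin_supp" "y \<in> fin_supp"
  have "{p. (x + y) p \<noteq> 0} \<subseteq> {p. x p \<noteq> 0} \<union> {p. y p \<noteq> 0}" by (auto simp: cvec_apply)
  with * show "x + y \<in> fin_supp"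
    unfolding fin_supp_def mem_Collect_eq by (metis finite_UnI finite_subset)
  have "{p. (c *\<^sub>C x) p \<noteq> 0} \<subseteq> {p. x p \<noteq> 0}" by (auto simp: cvec_apply)
  with * show "c *\<^sub>C x \<in> fin_supp"
    unfolding fin_supp_def mem_Collect_eq by (metis finite_subset)
qed (simp add: fin_supp_def cvec_apply)

text \<open>The support changes with the vector; a common finite superset is what allows
  \<open>lin_ext\<close> of several vectors to be compared.\<close>

lemma lin_ext_eq_sum:
  assumes "finite S" and "{p. x p \<noteq> 0} \<subseteq> S"
  shows "lin_ext \<phi> x = (\<Sum>p\<in>S. x p * \<phi> p)"
  unfolding lin_ext_def using assms by (intro sum.mono_neutral_left) auto

lemma lin_ext_0 [simp]: "lin_ext \<phi> 0 = 0"
  by (simp add: lin_ext_def cvec_apply)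

text \<open>Finite support is essential: a sum over an infinite support is 0 by convention, and
  additivity would fail.\<close>

lemma lin_ext_add:
  assumes "x \<in> fin_supp" "y \<in> fin_supp"
  shows "lin_ext \<phi> (x + y) = lin_ext \<phi> x + lin_ext \<phi> y"
proof -
  let ?S = "{p. x p \<noteq> 0} \<union> {p. y p \<noteq> 0}"
  have S: "finite ?S" using assms by (simp add: fin_supp_def)
  have "lin_ext \<phi> (x + y) = (\<Sum>p\<in>?S. (x + y) p * \<phi> p)"
    by (rule lin_ext_eq_sum[OF S]) (auto simp: cvec_apply)
  moreover have "lin_ext \<phi> x = (\<Sum>p\<in>?S. x p * \<phi> p)" "lin_ext \<phi> y = (\<Sum>p\<in>?S. y p * \<phi> p)"
    by (rule lin_ext_eq_sum[OF S]; auto)+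
  ultimately show ?thesis by (simp add: cvec_apply distrib_right sum.distrib)
qed

lemma lin_ext_scale: "lin_ext \<phi> (c *\<^sub>C x) = c * lin_ext \<phi> x"
proof (cases "c = 0")
  case False
  then have "{p. (c *\<^sub>C x) p \<noteq> 0} = {p. x p \<noteq> 0}" by (auto simp: cvec_apply)
  then show ?thesis by (simp add: lin_ext_def cvec_apply sum_distrib_left mult.assoc)
qed (simp add: lin_ext_def cvec_apply)

lemma lin_ext_sum:
  assumes "\<And>i. i \<in> S \<Longrightarrow> x i \<in> fin_supp"
  shows "lin_ext \<phi> (\<Sum>i\<in>S. x i) = (\<Sum>i\<in>S. lin_ext \<phi> (x i))"
  using assms
proof (induction S rule: infinite_finite_induct)
  case (insert i S)
  have "(\<Sum>i\<in>S. x i) \<in> fin_supp"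
    using insert.prems by (intro cvec.subspace_sum[OF subspace_fin_supp]) auto
  with insert show ?case by (simp add: lin_ext_add)
qed auto

lemma lin_ext_basis_vec [simp]: "lin_ext \<phi> (basis_vec p) = \<phi> p"
proof -
  have "lin_ext \<phi> (basis_vec p) = (\<Sum>q\<in>{p}. basis_vec p q * \<phi> q)"
    by (rule lin_ext_eq_sum) (auto simp: basis_vec_def)
  then show ?thesis by (simp add: basis_vec_def)
qed

section \<open>Tensors\<close>

lemma tensor_apply [simp]: "(x \<otimes>\<^sub>v y) (p, q) = x p * y q"
  by (simp add: tensor_def)

lemma tensor_add_left: "(x + x') \<otimes>\<^sub>v y = x \<otimes>\<^sub>v y + x' \<otimes>\<^sub>v y"
  and tensor_add_right: "x \<otimes>\<^sub>v (y + y') = x \<otimes>\<^sub>v y + x \<otimes>\<^sub>v y'"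
  and tensor_scale_left: "(c *\<^sub>C x) \<otimes>\<^sub>v y = c *\<^sub>C (x \<otimes>\<^sub>v y)"
  and tensor_scale_right: "x \<otimes>\<^sub>v (c *\<^sub>C y) = c *\<^sub>C (x \<otimes>\<^sub>v y)"
  by (auto simp: tensor_def fun_eq_iff cvec_apply algebra_simps)

lemma tensor_minus_left: "(- x) \<otimes>\<^sub>v y = - (x \<otimes>\<^sub>v y)"
  by (auto simp: tensor_def fun_eq_iff)

lemma tensor_basis_vec: "basis_vec p \<otimes>\<^sub>v basis_vec q = basis_vec (p, q)"
  by (auto simp: tensor_def basis_vec_def fun_eq_iff)

lemma tensor_fin_supp:
  assumes "x \<in> fin_supp" "y \<in> fin_supp"
  shows "x \<otimes>\<^sub>v y \<in> fin_supp"
proof -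
  have "{r. (x \<otimes>\<^sub>v y) r \<noteq> 0} \<subseteq> {p. x p \<noteq> 0} \<times> {q. y q \<noteq> 0}" by auto
  then show ?thesis using assms unfolding fin_supp_def by (auto intro: finite_subset)
qed

lemma tensor_space_fin_supp:
  assumes "U \<subseteq> fin_supp" "W \<subseteq> fin_supp"
  shows "tensor_space U W \<subseteq> fin_supp"
  unfolding tensor_space_def
  using assms by (intro cvec.span_minimal subspace_fin_supp) (auto intro!: tensor_fin_supp)

lemma lin_ext_tensor:
  assumes "x \<in> fin_supp" "y \<in> fin_supp"
  shows "lin_ext \<phi> (x \<otimes>\<^sub>v y) = (\<Sum>p | x p \<noteq> 0. \<Sum>q | y q \<noteq> 0. x p * y q * \<phi> (p, q))"
proof -
  have "lin_ext \<phi> (x \<otimes>\<^sub>v y) = (\<Sum>r\<in>{p. x p \<noteq> 0} \<times> {q. y q \<noteq> 0}. (x \<otimes>\<^sub>v y) r * \<phi> r)"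
    using assms by (intro lin_ext_eq_sum) (auto simp: fin_supp_def)
  then show ?thesis by (simp add: sum.cartesian_product case_prod_unfold tensor_def)
qed

text \<open>Functionals are given by coefficient functions, which have the same type as vectors.
  Hence \<open>\<otimes>\<^sub>v\<close> of two of them also encodes the tensor product of the
  functionals.\<close>

lemma lin_ext_tensor_tensor:
  assumes "x \<in> fin_supp" "y \<in> fin_supp"
  shows "lin_ext (\<phi> \<otimes>\<^sub>v \<psi>) (x \<otimes>\<^sub>v y) = lin_ext \<phi> x * lin_ext \<psi> y"
  unfolding lin_ext_tensor[OF assms] unfolding lin_ext_def
  by (simp add: sum_product mult.assoc mult.left_commute)

lemma lin_ext_sum_tensor:
  assumes "\<And>i. i \<in> S \<Longrightarrow> x i \<in> fin_supp" "\<And>i. i \<in> S \<Longrightarrow> y i \<in> fin_supp"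
  shows "lin_ext (\<phi> \<otimes>\<^sub>v \<psi>) (\<Sum>i\<in>S. x i \<otimes>\<^sub>v y i) = (\<Sum>i\<in>S. lin_ext \<phi> (x i) * lin_ext \<psi> (y i))"
proof -
  have "lin_ext (\<phi> \<otimes>\<^sub>v \<psi>) (\<Sum>i\<in>S. x i \<otimes>\<^sub>v y i) = (\<Sum>i\<in>S. lin_ext (\<phi> \<otimes>\<^sub>v \<psi>) (x i \<otimes>\<^sub>v y i))"
    by (rule lin_ext_sum) (simp add: assms tensor_fin_supp)
  then show ?thesis by (simp add: assms lin_ext_tensor_tensor)
qed

lemma tensor_mem: "x \<in> U \<Longrightarrow> y \<in> W \<Longrightarrow> x \<otimes>\<^sub>v y \<in> tensor_space U W"
  unfolding tensor_space_def by (rule cvec.span_base) blast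

lemma subspace_tensor_space: "cvec.subspace (tensor_space U W)"
  by (simp add: tensor_space_def)

lemma tensor_space_sum_mem:
  assumes "\<And>i. i \<in> S \<Longrightarrow> x i \<in> U" "\<And>i. i \<in> S \<Longrightarrow> y i \<in> W"
  shows "(\<Sum>i\<in>S. x i \<otimes>\<^sub>v y i) \<in> tensor_space U W"
  using assms by (intro cvec.subspace_sum[OF subspace_tensor_space] tensor_mem)

text \<open>Scalars of the span are absorbed into the left factors, which gives exactly the
  decompositions that \<open>tensor_lift\<close> quantifies over.\<close>

lemma tensor_space_sumE:
  assumes U: "cvec.subspace U" and t: "t \<in> tensor_space U W"
  obtains m a b where "\<And>i. i < m \<Longrightarrow> a i \<in> U" "\<And>i. i < m \<Longrightarrow> b i \<in> W"
    "t = (\<Sum>i<m::nat. a i \<otimes>\<^sub>v b i)"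
proof -
  let ?P = "\<lambda>t. \<exists>(m::nat) a b. (\<forall>i<m. a i \<in> U \<and> b i \<in> W) \<and> t = (\<Sum>i<m. a i \<otimes>\<^sub>v b i)"
  have "?P t"
    using t unfolding tensor_space_def
  proof (induction rule: cvec.span_induct_alt)
    case base
    show ?case by (rule exI[of _ 0]) simp
  next
    case (step c x y)
    then obtain u w m a b where x: "x = u \<otimes>\<^sub>v w" "u \<in> U" "w \<in> W"
      and y: "\<forall>i<m. a i \<in> U \<and> b i \<in> W" "y = (\<Sum>i<m::nat. a i \<otimes>\<^sub>v b i)"
      by blast
    let ?a = "a(m := c *\<^sub>C u)" and ?b = "b(m := w)"
    have "(\<Sum>i<m. ?a i \<otimes>\<^sub>v ?b i) = y"
      unfolding y by (rule sum.cong) auto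
    then have "c *\<^sub>C x + y = (\<Sum>i<Suc m. ?a i \<otimes>\<^sub>v ?b i)"
      by (simp add: x tensor_scale_left add.commute)
    moreover have "\<forall>i<Suc m. ?a i \<in> U \<and> ?b i \<in> W"
      using x y U by (auto simp: less_Suc_eq cvec.subspace_scale)
    ultimately show ?case by blast
  qed
  then show thesis using that by blast
qed

section \<open>Well-defined maps out of tensor products\<close>

lemma additive_on_sum:
  fixes f :: "'p cvec \<Rightarrow> 'q cvec"
  assumes U: "cvec.subspace U"
    and add: "\<And>x y. x \<in> U \<Longrightarrow> y \<in> U \<Longrightarrow> f (x + y) = f x + f y"
    and x: "\<And>i. i \<in> S \<Longrightarrow> x i \<in> U"
  shows "f (\<Sum>i\<in>S. x i) = (\<Sum>i\<in>S. f (x i))"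
proof -
  have zero: "f 0 = 0"
    using add[of 0 0] U by (simp add: cvec.subspace_0)
  show ?thesis
    using x
  proof (induction S rule: infinite_finite_induct)
    case (insert i S)
    then have "(\<Sum>i\<in>S. x i) \<in> U" by (intro cvec.subspace_sum[OF U]) auto
    with insert show ?case by (simp add: add)
  qed (auto simp: zero)
qed

text \<open>Expanding the right factors in a basis moves all scalars to the left factors, which then vanish.\<close>

lemma balanced_sum_eq_0:
  fixes B :: "'p cvec \<Rightarrow> 'q cvec \<Rightarrow> 'r cvec"
  assumes U: "cvec.subspace U" and W: "cvec.subspace W"
    and addl: "\<And>a a' b. a \<in> U \<Longrightarrow> a' \<in> U \<Longrightarrow> b \<in> W \<Longrightarrow> B (a + a') b = B a b + B a' b"
    and addr: "\<And>a b b'. a \<in> U \<Longrightarrow> b \<in> W \<Longrightarrow> b' \<in> W \<Longrightarrow> B a (b + b') = B a b + B a b'"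
    and bal: "\<And>c a b. a \<in> U \<Longrightarrow> b \<in> W \<Longrightarrow> B (c *\<^sub>C a) b = B a (c *\<^sub>C b)"
    and S: "finite S" "\<And>i. i \<in> S \<Longrightarrow> a i \<in> U" "\<And>i. i \<in> S \<Longrightarrow> b i \<in> W"
    and zero: "(\<Sum>i\<in>S. a i \<otimes>\<^sub>v b i) = 0"
  shows "(\<Sum>i\<in>S. B (a i) (b i)) = 0"
proof -
  obtain K where K: "K \<subseteq> b ` S" "cvec.independent K" "b ` S \<subseteq> cvec.span K"
    using cvec.maximal_independent_subset[of "b ` S"] by blast
  have fK: "finite K" using K(1) S(1) finite_surj by blast
  have KW: "k \<in> W" if "k \<in> K" for k using that K(1) S(3) by blast
  define c where "c i = cvec.representation K (b i)" for i
  have b: "b i = (\<Sum>k\<in>K. c i k *\<^sub>C k)" if "i \<in> S" for i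
    unfolding c_def
    by (rule cvec.sum_representation_eq[OF K(2) _ fK order_refl, symmetric]) (use K(3) that in blast)
  \<comment> \<open>Fixing the coordinate \<open>p\<close> of the left factors turns the vanishing
    tensor into a linear relation among the independent vectors in \<open>K\<close>.\<close>
  have coeff: "(\<Sum>i\<in>S. c i k *\<^sub>C a i) = 0" if "k \<in> K" for k
  proof
    fix p
    let ?u = "\<lambda>k. \<Sum>i\<in>S. c i k * a i p"
    have "(\<Sum>k\<in>K. ?u k *\<^sub>C k) = 0"
    proof
      fix q
      have "(\<Sum>k\<in>K. ?u k *\<^sub>C k) q = (\<Sum>i\<in>S. a i p * (\<Sum>k\<in>K. c i k * k q))"
        unfolding cvec_apply sum_distrib_right sum_distrib_left
        by (subst sum.swap) (simp add: ac_simps)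
      also have "\<dots> = (\<Sum>i\<in>S. a i p * b i q)"
        by (rule sum.cong[OF refl]) (subst b, auto simp: cvec_apply)
      also have "\<dots> = (\<Sum>i\<in>S. a i \<otimes>\<^sub>v b i) (p, q)" by (simp add: cvec_apply)
      finally show "(\<Sum>k\<in>K. ?u k *\<^sub>C k) q = 0 q" by (simp add: zero cvec_apply)
    qed
    then have "?u k = 0"
      by (rule cvec.independentD[OF K(2) fK order_refl _ that, where u = ?u])
    then show "(\<Sum>i\<in>S. c i k *\<^sub>C a i) p = 0 p" by (simp add: cvec_apply)
  qed
  have B0: "B 0 k = 0" if "k \<in> W" for k
    using addl[of 0 0 k] that U by (simp add: cvec.subspace_0)
  have "(\<Sum>i\<in>S. B (a i) (b i)) = (\<Sum>i\<in>S. \<Sum>k\<in>K. B (a i) (c i k *\<^sub>C k))"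
  proof (rule sum.cong[OF refl])
    fix i assume i: "i \<in> S"
    have "B (a i) (\<Sum>k\<in>K. c i k *\<^sub>C k) = (\<Sum>k\<in>K. B (a i) (c i k *\<^sub>C k))"
      by (rule additive_on_sum[OF W]) (auto simp: addr S i KW cvec.subspace_scale[OF W])
    then show "B (a i) (b i) = (\<Sum>k\<in>K. B (a i) (c i k *\<^sub>C k))"
      using b[OF i] by simp
  qed
  also have "\<dots> = (\<Sum>k\<in>K. \<Sum>i\<in>S. B (c i k *\<^sub>C a i) k)"
    by (subst sum.swap) (simp add: bal S KW)
  also have "\<dots> = (\<Sum>k\<in>K. B (\<Sum>i\<in>S. c i k *\<^sub>C a i) k)"
    by (intro sum.cong[OF refl] additive_on_sum[OF U, symmetric])
      (auto simp: addl S KW cvec.subspace_scale[OF U])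
  also have "\<dots> = 0" by (intro sum.neutral) (auto simp: coeff B0 KW)
  finally show ?thesis .
qed

text \<open>\<open>tensor_lift\<close> is a definite description, so its value must not depend on
  the decomposition. Two decompositions of one tensor combine into a decomposition of zero, to which
  \<open>balanced_sum_eq_0\<close> applies. Additivity and balance of \<open>B\<close> suffice, so
  pairs of conjugate linear maps are covered too.\<close>

lemma tensor_lift_sum:
  fixes B :: "'p cvec \<Rightarrow> 'q cvec \<Rightarrow> 'r cvec"
  assumes U: "cvec.subspace U" and W: "cvec.subspace W"
    and addl: "\<And>a a' b. a \<in> U \<Longrightarrow> a' \<in> U \<Longrightarrow> b \<in> W \<Longrightarrow> B (a + a') b = B a b + B a' b"
    and addr: "\<And>a b b'. a \<in> U \<Longrightarrow> b \<in> W \<Longrightarrow> b' \<in> W \<Longrightarrow> B a (b + b') = B a b + B a b'"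
    and bal: "\<And>c a b. a \<in> U \<Longrightarrow> b \<in> W \<Longrightarrow> B (c *\<^sub>C a) b = B a (c *\<^sub>C b)"
    and ab: "\<And>i. i < m \<Longrightarrow> a i \<in> U" "\<And>i. i < m \<Longrightarrow> b i \<in> W"
  shows "tensor_lift U W B (\<Sum>i<m::nat. a i \<otimes>\<^sub>v b i) = (\<Sum>i<m. B (a i) (b i))"
  unfolding tensor_lift_def
proof (rule the_equality)
  show "\<exists>m' a' b'. (\<forall>i<m'. a' i \<in> U \<and> b' i \<in> W) \<and>
      (\<Sum>i<m. a i \<otimes>\<^sub>v b i) = (\<Sum>i<m'::nat. a' i \<otimes>\<^sub>v b' i) \<and>
      (\<Sum>i<m. B (a i) (b i)) = (\<Sum>i<m'. B (a' i) (b' i))"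
    using ab by blast
next
  fix z
  assume "\<exists>m' a' b'. (\<forall>i<m'. a' i \<in> U \<and> b' i \<in> W) \<and>
      (\<Sum>i<m. a i \<otimes>\<^sub>v b i) = (\<Sum>i<m'::nat. a' i \<otimes>\<^sub>v b' i) \<and> z = (\<Sum>i<m'. B (a' i) (b' i))"
  then obtain m' :: nat and a' b' where
    ab': "\<And>i. i < m' \<Longrightarrow> a' i \<in> U" "\<And>i. i < m' \<Longrightarrow> b' i \<in> W"
    and eq: "(\<Sum>i<m. a i \<otimes>\<^sub>v b i) = (\<Sum>i<m'. a' i \<otimes>\<^sub>v b' i)"
    and z: "z = (\<Sum>i<m'. B (a' i) (b' i))"
    by blast
  \<comment> \<open>The disjoint union of the index sets carries both decompositions, the second one
    with negated left factors.\<close>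
  define c where "c = case_sum a (\<lambda>i. (-1) *\<^sub>C a' i)"
  define d where "d = case_sum b b'"
  have "(\<Sum>i\<in>{..<m} <+> {..<m'}. B (c i) (d i)) = 0"
  proof (rule balanced_sum_eq_0[of U W B, OF U W addl addr bal])
    have "(\<Sum>i\<in>{..<m} <+> {..<m'}. c i \<otimes>\<^sub>v d i) =
        (\<Sum>i<m. a i \<otimes>\<^sub>v b i) + (-1) *\<^sub>C (\<Sum>i<m'. a' i \<otimes>\<^sub>v b' i)"
      by (simp add: sum.Plus c_def d_def tensor_minus_left sum_negf)
    then show "(\<Sum>i\<in>{..<m} <+> {..<m'}. c i \<otimes>\<^sub>v d i) = 0"
      unfolding eq by simp
  qed (use ab ab' cvec.subspace_scale[OF U, of _ "-1"] in \<open>auto simp: c_def d_def\<close>)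
  moreover have "B ((-1) *\<^sub>C a' i) (b' i) = - B (a' i) (b' i)" if "i < m'" for i
  proof -
    have "B (a' i + (-1) *\<^sub>C a' i) (b' i) = B (a' i) (b' i) + B ((-1) *\<^sub>C a' i) (b' i)"
      using ab' that by (intro addl cvec.subspace_scale[OF U])
    moreover have "B 0 (b' i) = 0"
      using addl[of 0 0 "b' i"] U ab'(2)[OF that] by (simp add: cvec.subspace_0)
    ultimately show ?thesis by (simp add: eq_neg_iff_add_eq_0 add.commute)
  qed
  ultimately have "(\<Sum>i<m. B (a i) (b i)) - (\<Sum>i<m'. B (a' i) (b' i)) = 0"
    by (simp add: sum.Plus c_def d_def sum_negf)
  then show "z = (\<Sum>i<m. B (a i) (b i))" unfolding z by simp
qed

text \<open>The rule \<open>\<sigma>\<close> is the identity for \<Delta> and complex conjugation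
  for the star. The map is balanced because both factors obey the same rule.\<close>

lemma tensor_map_sum:
  assumes U: "cvec.subspace U" and W: "cvec.subspace W"
    and f: "\<And>a a'. a \<in> U \<Longrightarrow> a' \<in> U \<Longrightarrow> f (a + a') = f a + f a'"
    and g: "\<And>b b'. b \<in> W \<Longrightarrow> b' \<in> W \<Longrightarrow> g (b + b') = g b + g b'"
    and \<sigma>: "\<And>c a. a \<in> U \<Longrightarrow> f (c *\<^sub>C a) = \<sigma> c *\<^sub>C f a" "\<And>c b. b \<in> W \<Longrightarrow> g (c *\<^sub>C b) = \<sigma> c *\<^sub>C g b"
    and ab: "\<And>i. i < m \<Longrightarrow> a i \<in> U" "\<And>i. i < m \<Longrightarrow> b i \<in> W"
  shows "tensor_map U W f g (\<Sum>i<m::nat. a i \<otimes>\<^sub>v b i) = (\<Sum>i<m. f (a i) \<otimes>\<^sub>v g (b i))"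
  unfolding tensor_map_def
  by (rule tensor_lift_sum[OF U W])
    (use ab in \<open>simp_all add: f g \<sigma> tensor_add_left tensor_add_right tensor_scale_left tensor_scale_right\<close>)

section \<open>Reassociating triple tensors\<close>

lemma reassoc_sum_tensor:
  "reassoc (\<Sum>i\<in>S. a i \<otimes>\<^sub>v t i) = (\<Sum>i\<in>S. reassoc (a i \<otimes>\<^sub>v t i))"
  by (auto simp: reassoc_def fun_eq_iff cvec_apply)

lemma reassoc_mem:
  assumes U: "cvec.subspace U" and W: "cvec.subspace W"
    and t: "t \<in> tensor_space U (tensor_space W Z)"
  shows "reassoc t \<in> tensor_space (tensor_space U W) Z"
proof -
  obtain m a s where as: "\<And>i. i < m \<Longrightarrow> a i \<in> U" "\<And>i. i < m \<Longrightarrow> s i \<in> tensor_space W Z"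
    and t: "t = (\<Sum>i<m::nat. a i \<otimes>\<^sub>v s i)"
    using tensor_space_sumE[OF U t] by blast
  have "reassoc (a i \<otimes>\<^sub>v s i) \<in> tensor_space (tensor_space U W) Z" if i: "i < m" for i
  proof -
    obtain n b c where bc: "\<And>j. j < n \<Longrightarrow> b j \<in> W" "\<And>j. j < n \<Longrightarrow> c j \<in> Z"
      and s: "s i = (\<Sum>j<n::nat. b j \<otimes>\<^sub>v c j)"
      using tensor_space_sumE[OF W as(2)[OF i]] by blast
    have "reassoc (a i \<otimes>\<^sub>v s i) = (\<Sum>j<n. (a i \<otimes>\<^sub>v b j) \<otimes>\<^sub>v c j)"
      by (auto simp: s reassoc_def fun_eq_iff cvec_apply sum_distrib_left mult.assoc)
    also have "\<dots> \<in> tensor_space (tensor_space U W) Z"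
      using bc as(1)[OF i] by (intro tensor_space_sum_mem) (auto intro: tensor_mem)
    finally show ?thesis .
  qed
  then show ?thesis
    unfolding t reassoc_sum_tensor by (intro cvec.subspace_sum subspace_tensor_space) auto
qed

lemma lin_ext_reassoc: "lin_ext ((\<phi> \<otimes>\<^sub>v \<psi>) \<otimes>\<^sub>v \<theta>) (reassoc t) = lin_ext (\<phi> \<otimes>\<^sub>v (\<psi> \<otimes>\<^sub>v \<theta>)) t"
  unfolding lin_ext_def
  by (rule sum.reindex_bij_witness[of _ "\<lambda>(p, (q, r)). ((p, q), r)" "\<lambda>((p, q), r). (p, (q, r))"])
    (auto simp: reassoc_def)

section \<open>Separating families of functionals\<close>

definition separating :: "('p \<Rightarrow> complex) set \<Rightarrow> 'p cvec set \<Rightarrow> bool"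
  where "separating \<Phi> U \<longleftrightarrow> (\<forall>x\<in>U. (\<forall>\<phi>\<in>\<Phi>. lin_ext \<phi> x = 0) \<longrightarrow> x = 0)"

lemma separatingD:
  assumes "separating \<Phi> U" "cvec.subspace U" "U \<subseteq> fin_supp" "x \<in> U" "y \<in> U"
    and "\<And>\<phi>. \<phi> \<in> \<Phi> \<Longrightarrow> lin_ext \<phi> x = lin_ext \<phi> y"
  shows "x = y"
proof -
  let ?z = "x + (-1) *\<^sub>C y"
  have y: "(-1) *\<^sub>C y \<in> U" by (rule cvec.subspace_scale[OF assms(2,5)])
  have "?z \<in> U" by (rule cvec.subspace_add[OF assms(2,4) y])
  moreover have "lin_ext \<phi> ?z = 0" if "\<phi> \<in> \<Phi>" for \<phi>
    using lin_ext_add[OF subsetD[OF assms(3,4)] subsetD[OF assms(3) y], of \<phi>] assms(6)[OF that]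
    by (simp only: lin_ext_scale) simp
  ultimately have "?z = 0"
    using assms(1) unfolding separating_def by blast
  then show ?thesis by simp
qed

text \<open>Slicing a tensor along one factor reduces to separation in each factor.\<close>

lemma separating_tensor:
  fixes U :: "'p cvec set" and W :: "'q cvec set"
  assumes U: "cvec.subspace U" "U \<subseteq> fin_supp" and W: "cvec.subspace W" "W \<subseteq> fin_supp"
    and sep: "separating \<Phi> U" "separating \<Psi> W"
  shows "separating {\<phi> \<otimes>\<^sub>v \<psi> | \<phi> \<psi>. \<phi> \<in> \<Phi> \<and> \<psi> \<in> \<Psi>} (tensor_space U W)"
  unfolding separating_def
proof (intro ballI impI)
  fix t assume t: "t \<in> tensor_space U W"
    and z: "\<forall>\<theta>\<in>{\<phi> \<otimes>\<^sub>v \<psi> | \<phi> \<psi>. \<phi> \<in> \<Phi> \<and> \<psi> \<in> \<Psi>}. lin_ext \<theta> t = 0"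
  obtain m a b where ab: "\<And>i. i < m \<Longrightarrow> a i \<in> U" "\<And>i. i < m \<Longrightarrow> b i \<in> W"
    and t: "t = (\<Sum>i<m::nat. a i \<otimes>\<^sub>v b i)"
    using tensor_space_sumE[OF U(1) t] by blast
  have aS: "a i \<in> fin_supp" "b i \<in> fin_supp" if "i < m" for i using ab that U W by blast+
  have slice: "(\<Sum>i<m. lin_ext \<phi> (a i) *\<^sub>C b i) = 0" if "\<phi> \<in> \<Phi>" for \<phi>
  proof -
    have "lin_ext \<psi> (\<Sum>i<m. lin_ext \<phi> (a i) *\<^sub>C b i) = 0" if "\<psi> \<in> \<Psi>" for \<psi>
    proof -
      have "lin_ext \<psi> (\<Sum>i<m. lin_ext \<phi> (a i) *\<^sub>C b i) = (\<Sum>i<m. lin_ext \<phi> (a i) * lin_ext \<psi> (b i))"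
        by (subst lin_ext_sum) (auto simp: lin_ext_scale aS cvec.subspace_scale[OF subspace_fin_supp])
      also have "\<dots> = lin_ext (\<phi> \<otimes>\<^sub>v \<psi>) t"
        unfolding t by (subst lin_ext_sum) (auto simp: lin_ext_tensor_tensor aS tensor_fin_supp)
      also have "\<dots> = 0" using z that \<open>\<phi> \<in> \<Phi>\<close> by blast
      finally show ?thesis .
    qed
    moreover have "(\<Sum>i<m. lin_ext \<phi> (a i) *\<^sub>C b i) \<in> W"
      using ab by (intro cvec.subspace_sum[OF W(1)] cvec.subspace_scale[OF W(1)]) auto
    ultimately show ?thesis using sep(2) unfolding separating_def by blast
  qed
  \<comment> \<open>Freezing the second index at \<open>q\<close> gives a vector of \<open>U\<close>
    whose value under \<phi> is the coordinate \<open>q\<close> of the slice, hence 0.\<close>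
  have "(\<Sum>i<m. b i q *\<^sub>C a i) = 0" for q
  proof -
    have "lin_ext \<phi> (\<Sum>i<m. b i q *\<^sub>C a i) = 0" if "\<phi> \<in> \<Phi>" for \<phi>
    proof -
      have "lin_ext \<phi> (\<Sum>i<m. b i q *\<^sub>C a i) = (\<Sum>i<m. lin_ext \<phi> (a i) *\<^sub>C b i) q"
        by (subst lin_ext_sum)
          (auto simp: lin_ext_scale cvec_apply mult.commute aS cvec.subspace_scale[OF subspace_fin_supp])
      then show ?thesis by (simp add: slice[OF that] cvec_apply)
    qed
    moreover have "(\<Sum>i<m. b i q *\<^sub>C a i) \<in> U"
      using ab by (intro cvec.subspace_sum[OF U(1)] cvec.subspace_scale[OF U(1)]) auto
    ultimately show ?thesis using sep(1) unfolding separating_def by blast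
  qed
  then have *: "(\<Sum>i<m. b i q *\<^sub>C a i) p = 0" for p q by (simp add: cvec_apply)
  show "t = 0"
  proof
    fix r :: "'p \<times> 'q"
    show "t r = 0 r"
      using *[where p = "fst r" and q = "snd r"]
      by (cases r) (simp add: t cvec_apply mult.commute)
  qed
qed

section \<open>Separation by star representations\<close>

text \<open>The linear map from coordinate columns to the ideal spanned by \<open>e\<close>. Entries
  at \<open>d\<close> and beyond are ignored, so it is injective only on columns that vanish
  there.\<close>

definition ideal_combination :: "(nat \<Rightarrow> 'p cvec) \<Rightarrow> nat \<Rightarrow> nat cvec \<Rightarrow> 'p cvec"
  where "ideal_combination e d v = (\<Sum>j<d. v j *\<^sub>C e j)"

lemma clinear_onD:
  assumes "clinear_on U W f"
  shows "a \<in> U \<Longrightarrow> f a \<in> W"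
    and "a \<in> U \<Longrightarrow> b \<in> U \<Longrightarrow> f (a + b) = f a + f b"
    and "a \<in> U \<Longrightarrow> f (c *\<^sub>C a) = c *\<^sub>C f a"
  using assms by (auto simp: clinear_on_def)

lemma clinear_on_sum:
  assumes f: "clinear_on U W f" and U: "cvec.subspace U" and x: "\<And>i. i \<in> S \<Longrightarrow> x i \<in> U"
  shows "f (\<Sum>i\<in>S. c i *\<^sub>C x i) = (\<Sum>i\<in>S. c i *\<^sub>C f (x i))"
proof -
  have "f (\<Sum>i\<in>S. c i *\<^sub>C x i) = (\<Sum>i\<in>S. f (c i *\<^sub>C x i))"
    by (rule additive_on_sum[OF U])
      (auto simp: clinear_onD[OF f] x cvec.subspace_scale[OF U])
  then show ?thesis by (simp add: clinear_onD[OF f] x)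
qed

context finite_dim_cstar_algebra
begin

section \<open>Minimal left ideals\<close>

definition left_ideal :: "'p cvec set \<Rightarrow> bool"
  where "left_ideal W \<longleftrightarrow> cvec.subspace W \<and> W \<subseteq> A \<and> (\<forall>a\<in>A. \<forall>w\<in>W. mul a w \<in> W)"

lemma mult_closed: "a \<in> A \<Longrightarrow> b \<in> A \<Longrightarrow> mul a b \<in> A"
  using clinear_onD(1)[OF mult_linear_right] .

lemma mult_zero_right: "a \<in> A \<Longrightarrow> mul a 0 = 0"
  using clinear_onD(3)[OF mult_linear_right, of a 0 0] cvec.subspace_0[OF subspace] by simp

text \<open>A consequence of the C*-identity, and the substitute for semisimplicity: a nonzero left
  ideal is never annihilated by the adjoints of its own elements.\<close>

lemma star_mult_self_eq_0:
  assumes "a \<in> A" "mul (star a) a = 0"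
  shows "a = 0"
proof -
  obtain N :: "'p cvec \<Rightarrow> real" where N: "\<forall>a\<in>A. N a \<ge> 0 \<and> (N a = 0 \<longleftrightarrow> a = 0)"
    "\<forall>a\<in>A. N (mul (star a) a) = (N a)\<^sup>2"
    using cstar_norm by metis
  have "(N a)\<^sup>2 = N 0" using N(2) assms by metis
  also have "N 0 = 0" using N(1) cvec.subspace_0[OF subspace] by blast
  finally show ?thesis using N(1) assms(1) by simp
qed

text \<open>A nonzero left ideal of least dimension inside \<open>N\<close> is minimal.\<close>

lemma minimal_left_ideal:
  assumes N: "left_ideal N" "N \<noteq> {0}"
  obtains W where "left_ideal W" "W \<subseteq> N" "W \<noteq> {0}"
    "\<And>V. left_ideal V \<Longrightarrow> V \<subseteq> W \<Longrightarrow> V \<noteq> {0} \<Longrightarrow> V = W"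
proof -
  let ?P = "\<lambda>W. left_ideal W \<and> W \<subseteq> N \<and> W \<noteq> {0}"
  define W where "W = (ARG_MIN cvec.dim W. ?P W)"
  have W: "?P W" "\<And>V. ?P V \<Longrightarrow> cvec.dim W \<le> cvec.dim V"
    using arg_min_nat_lemma[of ?P N cvec.dim] N unfolding W_def by auto
  show thesis
  proof
    fix V assume V: "left_ideal V" "V \<subseteq> W" "V \<noteq> {0}"
    obtain B where B: "finite B" "cvec.span B = A" using finite_dim by blast
    obtain C where C: "C \<subseteq> V" "cvec.independent C" "V \<subseteq> cvec.span C"
      using cvec.maximal_independent_subset by blast
    \<comment> \<open>A basis of \<open>V\<close> is extended to one of \<open>W\<close>; least
      dimension of \<open>W\<close> then forces the two bases to coincide.\<close>
    obtain D where D: "C \<subseteq> D" "D \<subseteq> W" "cvec.independent D" "W \<subseteq> cvec.span D"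
      using cvec.maximal_independent_subset_extend[of C W] C V(2) by blast
    have sV: "cvec.subspace V" and sW: "cvec.subspace W"
      using V(1) W(1) by (auto simp: left_ideal_def)
    have eV: "cvec.span C = V" and eW: "cvec.span D = W"
      using cvec.span_minimal[OF C(1) sV] cvec.span_minimal[OF D(2) sW] C(3) D(4) by auto
    have "D \<subseteq> cvec.span B" using D(2) W(1) B(2) by (auto simp: left_ideal_def)
    then have fD: "finite D" using cvec.independent_span_bound[OF B(1) D(3)] by blast
    have "card D \<le> card C"
      using W(2)[of V] V W(1) cvec.dim_span_eq_card_independent[OF C(2)]
        cvec.dim_span_eq_card_independent[OF D(3)] eV eW by auto
    then have "C = D" using card_seteq[OF fD D(1)] by blast
    then show "V = W" using eV eW by simp
  qed (use W(1) in auto)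
qed

text \<open>The matrices of left multiplication with respect to a basis of a minimal left ideal.\<close>

lemma minimal_left_ideal_rep:
  assumes W: "left_ideal W" "W \<noteq> {0}"
    and min: "\<And>V. left_ideal V \<Longrightarrow> V \<subseteq> W \<Longrightarrow> V \<noteq> {0} \<Longrightarrow> V = W"
  obtains d S e where "matrix_rep A mul one {..<d::nat} S" "irreducible_rep A {..<d} S"
    "W = cvec.span (e ` {..<d})"
    "\<And>a j. a \<in> A \<Longrightarrow> j < d \<Longrightarrow> mul a (e j) = (\<Sum>i<d. S i j a *\<^sub>C e i)"
proof -
  obtain B where B: "finite B" "cvec.span B = A" using finite_dim by blast
  obtain D where D: "D \<subseteq> W" "cvec.independent D" "W \<subseteq> cvec.span D"
    using cvec.maximal_independent_subset by blast
  have sW: "cvec.subspace W" and WA: "W \<subseteq> A"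
    and mW: "\<And>a w. a \<in> A \<Longrightarrow> w \<in> W \<Longrightarrow> mul a w \<in> W"
    using W(1) by (auto simp: left_ideal_def)
  have eW: "cvec.span D = W" using cvec.span_minimal[OF D(1) sW] D(3) by auto
  have fD: "finite D"
    using cvec.independent_span_bound[OF B(1) D(2)] D(1) WA B(2) by blast
  obtain e d where e: "bij_betw e {..<d::nat} D"
    using fD by (metis bij_betw_from_nat_into_finite)
  have eD: "e j \<in> D" "e j \<in> W" "e j \<in> A" if "j < d" for j
    using e that D(1) WA by (auto simp: bij_betw_def)
  have D_eq: "D = e ` {..<d}" and inj: "inj_on e {..<d}" using e by (auto simp: bij_betw_def)
  define rep where "rep = cvec.representation D"
  \<comment> \<open>Column \<open>j\<close> holds the coordinates of \<open>mul a (e j)\<close>;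
    this convention makes \<open>S\<close> multiplicative rather than antimultiplicative.\<close>
  define S where "S i j a = rep (mul a (e j)) (e i)" for i j a
  have rep_sum: "w = (\<Sum>i<d. rep w (e i) *\<^sub>C e i)" if "w \<in> W" for w
  proof -
    have "(\<Sum>b\<in>D. rep w b *\<^sub>C b) = w"
      unfolding rep_def using cvec.sum_representation_eq[OF D(2) _ fD order_refl] that eW by blast
    then show ?thesis unfolding D_eq sum.reindex[OF inj] by simp
  qed
  have rep_add: "rep (v + w) b = rep v b + rep w b" if "v \<in> W" "w \<in> W" for v w b
    unfolding rep_def using cvec.representation_add[OF D(2)] that eW by auto
  have rep_scale: "rep (c *\<^sub>C v) b = c * rep v b" if "v \<in> W" for v b c
    unfolding rep_def using cvec.representation_scale[OF D(2)] that eW by auto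
  have rep_comb: "rep (\<Sum>j<d. v j *\<^sub>C w j) b = (\<Sum>j<d. v j * rep (w j) b)"
    if w: "\<And>j. j < d \<Longrightarrow> w j \<in> W" for v w b
  proof -
    have "rep (\<Sum>j\<in>{..<d}. v j *\<^sub>C w j) b = (\<Sum>j\<in>{..<d}. rep (v j *\<^sub>C w j) b)"
      unfolding rep_def
      by (subst cvec.representation_sum[OF D(2)])
        (use w eW sW in \<open>auto intro: cvec.subspace_scale\<close>)
    then show ?thesis by (simp add: rep_scale[OF w])
  qed
  have rep_e: "rep (e j) (e i) = of_bool (i = j)" if "i < d" "j < d" for i j
    unfolding rep_def using cvec.representation_basis[OF D(2) eD(1)[OF that(2)]] inj that
    by (auto simp: inj_on_def)
  have mul_e: "mul a (e j) = (\<Sum>i<d. S i j a *\<^sub>C e i)" if "a \<in> A" "j < d" for a j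
    unfolding S_def using rep_sum mW eD that by blast
  \<comment> \<open>Passing to coordinates intertwines the matrix action with left multiplication.
    The conditional repeats the shape used in \<open>irreducible_rep\<close>.\<close>
  have mul_comb: "mul a (ideal_combination e d v) =
      ideal_combination e d (\<lambda>i. if i \<in> {..<d} then \<Sum>j\<in>{..<d}. S i j a * v j else 0)"
    if a: "a \<in> A" for a v
  proof -
    have "mul a (ideal_combination e d v) = (\<Sum>j<d. v j *\<^sub>C mul a (e j))"
      unfolding ideal_combination_def
      by (rule clinear_on_sum[OF mult_linear_right[OF a] subspace]) (simp add: eD)
    also have "\<dots> = (\<Sum>j<d. \<Sum>i<d. (S i j a * v j) *\<^sub>C e i)"
      by (simp add: mul_e[OF a] cvec.scale_sum_right mult.commute)
    also have "\<dots> = (\<Sum>i<d. (\<Sum>j<d. S i j a * v j) *\<^sub>C e i)"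
      by (subst sum.swap) (simp add: cvec.scale_sum_left)
    finally show ?thesis by (simp add: ideal_combination_def)
  qed
  have rep_ic: "rep (ideal_combination e d v) (e i) = v i" if "i < d" for v i
    unfolding ideal_combination_def using that
    by (subst rep_comb) (auto simp: eD rep_e of_bool_def if_distrib cong: if_cong)
  have ic_W: "ideal_combination e d v \<in> W" for v
    unfolding ideal_combination_def
    by (intro cvec.subspace_sum[OF sW] cvec.subspace_scale[OF sW]) (auto simp: eD)
  have "matrix_rep A mul one {..<d} S"
    unfolding matrix_rep_def
  proof (intro conjI ballI allI)
    fix i j assume ij: "i \<in> {..<d}" "j \<in> {..<d}"
    show "S i j (a + b) = S i j a + S i j b" if "a \<in> A" "b \<in> A" for a b
      using that ij unfolding S_def
      by (simp add: clinear_onD(2)[OF mult_linear_left] eD rep_add rep_scale mW)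
    show "S i j (c *\<^sub>C a) = c * S i j a" if "a \<in> A" for a c
      using that ij unfolding S_def
      by (simp add: clinear_onD(3)[OF mult_linear_left] eD rep_add rep_scale mW)
    show "S i j (mul a b) = (\<Sum>k\<in>{..<d}. S i k a * S k j b)" if a: "a \<in> A" and b: "b \<in> A" for a b
    proof -
      have "mul (mul a b) (e j) = mul a (ideal_combination e d (\<lambda>k. S k j b))"
        using ij by (simp add: mult_assoc a b eD mul_e[OF b] ideal_combination_def)
      then show ?thesis using ij unfolding S_def[of i j "mul a b"] by (simp add: mul_comb[OF a] rep_ic)
    qed
    show "S i j one = of_bool (i = j)"
      using ij by (simp add: S_def mult_one_left eD rep_e)
  qed simp
  moreover have "irreducible_rep A {..<d} S"
    unfolding irreducible_rep_def
  proof (intro conjI allI impI)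
    show "{..<d} \<noteq> {}"
      using W(2) eW D_eq by auto
    fix V :: "nat cvec set"
    assume "cvec.subspace V \<and> V \<subseteq> {w. \<forall>i. i \<notin> {..<d} \<longrightarrow> w i = 0} \<and>
      (\<forall>a\<in>A. \<forall>w\<in>V. (\<lambda>i. if i \<in> {..<d} then \<Sum>j\<in>{..<d}. S i j a * w j else 0) \<in> V)"
    then have V: "cvec.subspace V" "\<And>v i. v \<in> V \<Longrightarrow> \<not> i < d \<Longrightarrow> v i = 0"
      "\<And>a v. a \<in> A \<Longrightarrow> v \<in> V \<Longrightarrow> (\<lambda>i. if i \<in> {..<d} then \<Sum>j\<in>{..<d}. S i j a * v j else 0) \<in> V"
      by auto
    \<comment> \<open>Invariant spaces of columns become left ideals inside \<open>W\<close>, so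
      minimality of \<open>W\<close> yields irreducibility of \<open>S\<close>.\<close>
    let ?V = "ideal_combination e d ` V"
    have ext: "v = w" if "\<And>i. \<not> i < d \<Longrightarrow> v i = 0" "\<And>i. \<not> i < d \<Longrightarrow> w i = 0"
      "ideal_combination e d v = ideal_combination e d w" for v w
      using that rep_ic by (metis ext)
    have "left_ideal ?V"
      unfolding left_ideal_def
    proof (intro conjI ballI)
      show "cvec.subspace ?V"
      proof (rule cvec.subspaceI)
        show "0 \<in> ?V"
          using cvec.subspace_0[OF V(1)]
          by (intro image_eqI[where x = 0]) (auto simp: ideal_combination_def cvec_apply)
        fix x y c assume "x \<in> ?V"
        then obtain v where v: "v \<in> V" "x = ideal_combination e d v" by blast
        show "c *\<^sub>C x \<in> ?V"
          unfolding v(2) using cvec.subspace_scale[OF V(1) v(1), of c]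
          by (intro image_eqI[where x = "c *\<^sub>C v"])
            (auto simp: ideal_combination_def cvec.scale_sum_right cscale_apply)
        assume "y \<in> ?V"
        then obtain w where w: "w \<in> V" "y = ideal_combination e d w" by blast
        show "x + y \<in> ?V"
          unfolding v(2) w(2) using cvec.subspace_add[OF V(1) v(1) w(1)]
          by (intro image_eqI[where x = "v + w"])
            (auto simp: ideal_combination_def cvec.scale_left_distrib sum.distrib plus_fun_apply[of v w])
      qed
      show "?V \<subseteq> A" using ic_W WA by blast
      fix a x assume "a \<in> A" "x \<in> ?V"
      then show "mul a x \<in> ?V" using V(3) mul_comb by blast
    qed
    moreover have "?V \<subseteq> W" using ic_W by blast
    ultimately consider "?V = {0}" | "?V = W" using min by blast
    then show "V = {0} \<or> V = {w. \<forall>i. i \<notin> {..<d} \<longrightarrow> w i = 0}"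
    proof cases
      case 1
      have "v = 0" if "v \<in> V" for v
      proof (rule ext)
        show "ideal_combination e d v = ideal_combination e d 0"
          using 1 that by (auto simp: ideal_combination_def cvec_apply)
      qed (use V(2) that in \<open>auto simp: cvec_apply\<close>)
      then show ?thesis using cvec.subspace_0[OF V(1)] by blast
    next
      case 2
      have "w \<in> V" if w: "\<forall>i. i \<notin> {..<d} \<longrightarrow> w i = 0" for w
      proof -
        obtain v where v: "v \<in> V" "ideal_combination e d w = ideal_combination e d v"
          using 2 ic_W[of w] by blast
        have "w = v"
          by (rule ext) (use V(2)[OF v(1)] w v(2) in auto)
        then show ?thesis using v(1) by simp
      qed
      then show ?thesis using V(2) by auto
    qed
  qed
  ultimately show thesis
    using that eW D_eq mul_e by blast
qed

text \<open>
  The common kernel \<open>N\<close> is a star-closed left ideal that annihilates every irreducible module, in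
  particular a minimal left ideal \<open>W\<close> contained in \<open>N\<close>. Hence \<open>w\<^sup>* w = 0\<close> for \<open>w \<in> W\<close>.
\<close>

lemma star_reps_separate:
  fixes S :: "'k \<Rightarrow> ('j, 'p) coeffs"
  assumes rep: "\<And>k. k \<in> K \<Longrightarrow> matrix_star_rep A mul one star (J k) (S k)"
    and occ: "\<And>(d::nat) T. matrix_rep A mul one {..<d} T \<Longrightarrow> irreducible_rep A {..<d} T
      \<Longrightarrow> \<exists>k\<in>K. occurs_in A {..<d} T (J k) (S k)"
    and a: "a \<in> A" and zero: "\<And>k \<alpha> \<beta>. k \<in> K \<Longrightarrow> \<alpha> \<in> J k \<Longrightarrow> \<beta> \<in> J k \<Longrightarrow> S k \<alpha> \<beta> a = 0"
  shows "a = 0"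
proof (rule ccontr)
  assume "a \<noteq> 0"
  define N where "N = {a\<in>A. \<forall>k\<in>K. \<forall>\<alpha>\<in>J k. \<forall>\<beta>\<in>J k. S k \<alpha> \<beta> a = 0}"
  have lin: "S k \<alpha> \<beta> (a + b) = S k \<alpha> \<beta> a + S k \<alpha> \<beta> b" "S k \<alpha> \<beta> (c *\<^sub>C a) = c * S k \<alpha> \<beta> a"
    "S k \<alpha> \<beta> (mul a b) = (\<Sum>\<gamma>\<in>J k. S k \<alpha> \<gamma> a * S k \<gamma> \<beta> b)" "S k \<alpha> \<beta> (star a) = cnj (S k \<beta> \<alpha> a)"
    if "k \<in> K" "\<alpha> \<in> J k" "\<beta> \<in> J k" "a \<in> A" "b \<in> A" for k \<alpha> \<beta> a b c
    using rep[OF that(1)] that(2-) by (auto simp: matrix_star_rep_def matrix_rep_def)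
  have zero0: "S k \<alpha> \<beta> 0 = 0" if "k \<in> K" "\<alpha> \<in> J k" "\<beta> \<in> J k" for k \<alpha> \<beta>
    using lin(2)[OF that a a, of 0] by simp
  have "left_ideal N"
    unfolding left_ideal_def
  proof (intro conjI ballI)
    show "cvec.subspace N"
      by (rule cvec.subspaceI)
        (use subspace in \<open>auto simp: N_def lin zero0 cvec.subspace_0 cvec.subspace_add cvec.subspace_scale\<close>)
  qed (auto simp: N_def mult_closed lin)
  moreover have "N \<noteq> {0}" using a zero \<open>a \<noteq> 0\<close> by (auto simp: N_def)
  ultimately obtain W where W: "left_ideal W" "W \<subseteq> N" "W \<noteq> {0}"
    and min: "\<And>V. left_ideal V \<Longrightarrow> V \<subseteq> W \<Longrightarrow> V \<noteq> {0} \<Longrightarrow> V = W"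
    by (rule minimal_left_ideal) blast
  obtain d T e where T: "matrix_rep A mul one {..<d::nat} T" "irreducible_rep A {..<d} T"
    and e: "W = cvec.span (e ` {..<d})"
    and mul_e: "\<And>a j. a \<in> A \<Longrightarrow> j < d \<Longrightarrow> mul a (e j) = (\<Sum>i<d. T i j a *\<^sub>C e i)"
    by (rule minimal_left_ideal_rep[OF W(1,3)], erule (2) min) (rule that, assumption+)
  obtain k where k: "k \<in> K" "occurs_in A {..<d} T (J k) (S k)" using occ[OF T] by blast
  then obtain P Q where P: "intertwiner A {..<d} T (J k) (S k) P"
    and QP: "\<forall>i\<in>{..<d}. \<forall>l\<in>{..<d}. (\<Sum>j\<in>J k. Q i j * P j l) = of_bool (i = l)"
    unfolding occurs_in_def by blast
  \<comment> \<open>From \<open>Q P = 1\<close> and the intertwining property,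
    \<open>T n = Q P T n = Q (S n) P\<close>, and \<open>S\<close> vanishes on
    \<open>N\<close>.\<close>
  have T0: "T i l n = 0" if n: "n \<in> N" and il: "i < d" "l < d" for n i l
  proof -
    have "T i l n = (\<Sum>m<d. of_bool (i = m) * T m l n)"
      using il by (simp add: of_bool_def if_distrib[of "\<lambda>c. c * _"] cong: if_cong)
    also have "\<dots> = (\<Sum>m<d. (\<Sum>j\<in>J k. Q i j * P j m) * T m l n)"
      using QP il by simp
    also have "\<dots> = (\<Sum>j\<in>J k. Q i j * (\<Sum>m<d. P j m * T m l n))"
      by (simp add: sum_distrib_right sum_distrib_left mult.assoc) (rule sum.swap)
    also have "\<dots> = (\<Sum>j\<in>J k. Q i j * (\<Sum>l'\<in>J k. S k j l' n * P l' l))"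
      using P n il by (intro sum.cong refl) (auto simp: intertwiner_def N_def)
    also have "\<dots> = 0" using n k(1) by (intro sum.neutral) (auto simp: N_def)
    finally show ?thesis .
  qed
  have eA: "e j \<in> A" if "j < d" for j
    using W(1) e that cvec.span_base[of "e j" "e ` {..<d}"] by (auto simp: left_ideal_def)
  have kill: "mul n w = 0" if n: "n \<in> N" and w: "w \<in> W" for n w
  proof -
    have nA: "n \<in> A" using n by (simp add: N_def)
    have "cvec.subspace {w\<in>A. mul n w = 0}"
      by (rule cvec.subspaceI)
        (use subspace in \<open>auto simp: clinear_onD[OF mult_linear_right[OF nA]] mult_zero_right nA
          cvec.subspace_0 cvec.subspace_add cvec.subspace_scale\<close>)
    moreover have "mul n (e j) = 0" if "j < d" for j
      using mul_e[OF nA that] T0[OF n _ that] by simp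
    ultimately have "W \<subseteq> {w\<in>A. mul n w = 0}"
      unfolding e using eA by (intro cvec.span_minimal) auto
    then show ?thesis using w by blast
  qed
  obtain w where w: "w \<in> W" "w \<noteq> 0" using W(1,3) cvec.subspace_0 by (auto simp: left_ideal_def)
  have "star w \<in> N" using w(1) W(2) by (auto simp: N_def star_closed lin)
  then have "mul (star w) w = 0" using kill w(1) by blast
  then show False using star_mult_self_eq_0 w W(2) by (auto simp: N_def)
qed

end

section \<open>Paths\<close>

lemma finite_paths: "finite (paths (adj :: 'v::finite \<Rightarrow> 'v \<Rightarrow> bool) n)"
  by (rule finite_subset[OF _ finite_lists_length_eq[of UNIV "Suc n"]]) (auto simp: paths_def)

lemma paths_nonempty: "p \<in> paths adj n \<Longrightarrow> p \<noteq> []"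
  by (auto simp: paths_def)

lemma hd_concat_path: "p \<noteq> [] \<Longrightarrow> hd (p \<star> q) = hd p"
  by (simp add: concat_path_def)

lemma last_concat_path: "q \<noteq> [] \<Longrightarrow> last p = hd q \<Longrightarrow> last (p \<star> q) = last q"
  by (cases q; cases "tl q") (auto simp: concat_path_def)

text \<open>For \<open>q = []\<close> the right-hand side would drop one vertex too many from
  \<open>r\<close>.\<close>

lemma concat_path_assoc: "q \<noteq> [] \<Longrightarrow> (p \<star> q) \<star> r = p \<star> (q \<star> r)"
  by (cases q) (auto simp: concat_path_def)

lemma concat_path_mem:
  assumes "p \<in> paths adj m" "q \<in> paths adj n" "last p = hd q"
  shows "p \<star> q \<in> paths adj (m + n)"
  unfolding paths_def
proof (intro CollectI conjI allI impI)
  have len: "length p = Suc m" "length q = Suc n" using assms by (auto simp: paths_def)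
  then show "length (p \<star> q) = Suc (m + n)" by (simp add: concat_path_def)
  have mid: "p ! m = q ! 0"
    using assms(3) len by (metis diff_Suc_1 hd_conv_nth last_conv_nth length_0_conv nat.distinct(1))
  fix i assume i: "i < m + n"
  show "adj ((p \<star> q) ! i) ((p \<star> q) ! Suc i)"
  proof (cases "i < m")
    case True
    then show ?thesis using assms(1) len by (auto simp: concat_path_def nth_append paths_def)
  next
    case False
    have "(p \<star> q) ! Suc i = q ! Suc (i - m)" "(p \<star> q) ! i = q ! (i - m)"
      using False len i mid Suc_diff_Suc[of m i]
      by (auto simp: concat_path_def nth_append nth_tl Suc_diff_le less_Suc_eq)
    moreover have "i - m < n" using False i by simp
    ultimately show ?thesis using assms(2) by (simp add: paths_def)
  qed
qed

lemma take_concat_path: "p \<in> paths adj m \<Longrightarrow> take (Suc m) (p \<star> q) = p"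
  by (simp add: concat_path_def paths_def)

lemma drop_concat_path:
  assumes "p \<in> paths adj m" "q \<noteq> []" "last p = hd q"
  shows "drop m (p \<star> q) = q"
proof -
  have "length p = Suc m" using assms by (simp add: paths_def)
  then have "drop m p = [last p]"
    by (metis Suc_n_not_le_n append_butlast_last_id append_eq_conv_conj diff_Suc_1 length_butlast
        list.size(3) zero_le)
  then show ?thesis using assms \<open>length p = Suc m\<close> by (simp add: concat_path_def)
qed

text \<open>The two pieces overlap in the vertex at position \<open>m\<close>, hence
  \<open>take (Suc m)\<close> against \<open>drop m\<close>.\<close>

lemma split_path:
  assumes "c \<in> paths adj (m + n)"
  shows "take (Suc m) c \<in> paths adj m" "drop m c \<in> paths adj n"
    "last (take (Suc m) c) = hd (drop m c)" "take (Suc m) c \<star> drop m c = c"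
proof -
  have len: "length c = Suc (m + n)" using assms by (simp add: paths_def)
  show "take (Suc m) c \<in> paths adj m" "drop m c \<in> paths adj n"
    using assms len by (auto simp: paths_def min_def)
  show "last (take (Suc m) c) = hd (drop m c)"
    using len by (simp add: take_Suc_conv_app_nth hd_drop_conv_nth)
  show "take (Suc m) c \<star> drop m c = c"
    by (simp add: concat_path_def drop_Suc tl_drop[symmetric] del: take_Suc)
      (metis append_take_drop_id drop_Suc tl_drop)
qed

text \<open>Keeping non-composable pairs with value 0 leaves a plain product of index sets, where
  sums can be exchanged freely. This serves both for intermediate paths and for matrix
  indices.\<close>

lemma sum_paths_add:
  fixes g :: "'v::finite list \<Rightarrow> 'b::comm_monoid_add"
  shows "(\<Sum>c\<in>paths adj (m + n). g c) =
    (\<Sum>a\<in>paths adj m. \<Sum>b\<in>paths adj n. if last a = hd b then g (a \<star> b) else 0)"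
proof -
  let ?P = "paths adj m \<times> paths adj n"
  have "(\<Sum>c\<in>paths adj (m + n). g c) = (\<Sum>(a, b)\<in>{(a, b)\<in>?P. last a = hd b}. g (a \<star> b))"
    by (rule sum.reindex_bij_witness[of _ "\<lambda>(a, b). a \<star> b" "\<lambda>c. (take (Suc m) c, drop m c)"])
      (auto simp: split_path concat_path_mem take_concat_path drop_concat_path paths_nonempty
        simp del: take_Suc)
  also have "\<dots> = (\<Sum>x\<in>?P. if last (fst x) = hd (snd x) then g (fst x \<star> snd x) else 0)"
    by (intro sum.mono_neutral_cong_left) (auto simp: finite_paths)
  finally show ?thesis by (simp add: sum.cartesian_product case_prod_unfold)
qed

section \<open>Coefficients of tensor products of fundamental representations\<close>

text \<open>Rephrases the recursion, given by \<open>take 2\<close> and \<open>tl\<close>, through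
  concatenation. The remaining list must be nonempty: a singleton has its own clause and the empty
  list has coefficient 0.\<close>

lemma tensor_coeff_Cons:
  fixes adj :: "'v::finite \<Rightarrow> 'v \<Rightarrow> bool"
  assumes "fs \<noteq> []" "\<alpha> \<in> edges adj" "\<alpha>' \<in> edges adj" "p \<noteq> []" "p' \<noteq> []"
    "last \<alpha> = hd p" "last \<alpha>' = hd p'" "\<xi> \<in> paths adj n"
  shows "tensor_coeff adj \<phi> (f # fs) (\<alpha> \<star> p) (\<alpha>' \<star> p') (\<xi>, \<xi>') =
    (\<Sum>\<zeta>\<in>paths adj n. \<phi> f \<alpha> \<alpha>' (\<xi>, \<zeta>) * tensor_coeff adj \<phi> fs p p' (\<zeta>, \<xi>'))"
proof -
  obtain g gs where fs: "fs = g # gs" using assms(1) by (cases fs) auto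
  have "take (Suc 1) (\<alpha> \<star> p) = \<alpha>" "take (Suc 1) (\<alpha>' \<star> p') = \<alpha>'"
    by (rule take_concat_path[OF assms(2)], rule take_concat_path[OF assms(3)])
  moreover have "drop 1 (\<alpha> \<star> p) = p" "drop 1 (\<alpha>' \<star> p') = p'"
    by (rule drop_concat_path[OF assms(2,4,6)], rule drop_concat_path[OF assms(3,5,7)])
  moreover have "length \<xi> - 1 = n" using assms by (simp add: paths_def)
  ultimately show ?thesis by (simp add: fs drop_Suc numeral_2_eq_2)
qed

text \<open>Tensoring multiplies matrices in the path arguments, so the list may be split anywhere;
  associativity is here an exchange of the sums over intermediate paths.\<close>

lemma tensor_coeff_append:
  fixes adj :: "'v::finite \<Rightarrow> 'v \<Rightarrow> bool"
  assumes "fs \<noteq> []" "gs \<noteq> []" "p \<in> paths adj (length fs)" "p' \<in> paths adj (length fs)"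
    "q \<noteq> []" "q' \<noteq> []" "last p = hd q" "last p' = hd q'" "\<xi> \<in> paths adj n"
  shows "tensor_coeff adj \<phi> (fs @ gs) (p \<star> q) (p' \<star> q') (\<xi>, \<xi>') =
    (\<Sum>\<zeta>\<in>paths adj n. tensor_coeff adj \<phi> fs p p' (\<xi>, \<zeta>) * tensor_coeff adj \<phi> gs q q' (\<zeta>, \<xi>'))"
  using assms
proof (induction fs arbitrary: p p' \<xi> rule: list_nonempty_induct)
  case (single f)
  then show ?case using tensor_coeff_Cons[of gs p adj p' q q' \<xi> n \<phi> f \<xi>'] by simp
next
  case (cons f fs)
  have "length (f # fs) = 1 + length fs" by simp
  then have p: "p \<in> paths adj (1 + length fs)" "p' \<in> paths adj (1 + length fs)"
    using cons.prems by metis+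
  obtain \<alpha> r where r: "\<alpha> \<in> edges adj" "r \<in> paths adj (length fs)" "last \<alpha> = hd r" "p = \<alpha> \<star> r"
    using split_path[OF p(1)] by metis
  obtain \<alpha>' r' where r': "\<alpha>' \<in> edges adj" "r' \<in> paths adj (length fs)" "last \<alpha>' = hd r'" "p' = \<alpha>' \<star> r'"
    using split_path[OF p(2)] by metis
  have ne: "r \<noteq> []" "r' \<noteq> []" using r r' by (auto dest: paths_nonempty)
  have lst: "last r = hd q" "last r' = hd q'"
    using cons.prems r r' ne by (simp_all add: last_concat_path)
  have ne2: "r \<star> q \<noteq> []" "r' \<star> q' \<noteq> []" "hd (r \<star> q) = hd r" "hd (r' \<star> q') = hd r'"
    using ne by (auto simp: concat_path_def)
  have "tensor_coeff adj \<phi> ((f # fs) @ gs) (p \<star> q) (p' \<star> q') (\<xi>, \<xi>') =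
    (\<Sum>\<eta>\<in>paths adj n. \<phi> f \<alpha> \<alpha>' (\<xi>, \<eta>) * tensor_coeff adj \<phi> (fs @ gs) (r \<star> q) (r' \<star> q') (\<eta>, \<xi>'))"
    unfolding append_Cons r(4) r'(4) concat_path_assoc[OF ne(1)] concat_path_assoc[OF ne(2)]
    by (rule tensor_coeff_Cons) (use r r' ne2 cons in auto)
  also have "\<dots> = (\<Sum>\<eta>\<in>paths adj n. \<Sum>\<zeta>\<in>paths adj n. \<phi> f \<alpha> \<alpha>' (\<xi>, \<eta>) *
      tensor_coeff adj \<phi> fs r r' (\<eta>, \<zeta>) * tensor_coeff adj \<phi> gs q q' (\<zeta>, \<xi>'))"
    using cons.IH[OF \<open>gs \<noteq> []\<close> r(2) r'(2) \<open>q \<noteq> []\<close> \<open>q' \<noteq> []\<close> lst]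
    by (simp add: sum_distrib_left mult.assoc)
  also have "\<dots> = (\<Sum>\<zeta>\<in>paths adj n. (\<Sum>\<eta>\<in>paths adj n. \<phi> f \<alpha> \<alpha>' (\<xi>, \<eta>) *
      tensor_coeff adj \<phi> fs r r' (\<eta>, \<zeta>)) * tensor_coeff adj \<phi> gs q q' (\<zeta>, \<xi>'))"
    by (subst sum.swap) (simp add: sum_distrib_right)
  also have "\<dots> = (\<Sum>\<zeta>\<in>paths adj n. tensor_coeff adj \<phi> (f # fs) p p' (\<xi>, \<zeta>) *
      tensor_coeff adj \<phi> gs q q' (\<zeta>, \<xi>'))"
    unfolding r(4) r'(4)
    by (subst tensor_coeff_Cons[OF cons.hyps(1) r(1) r'(1) ne r(3) r'(3) cons.prems(8)]) simp_all
  finally show ?case .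
qed

context double_triangle_algebra
begin

abbreviation T :: "'f list \<Rightarrow> 'v list \<Rightarrow> 'v list \<Rightarrow> 'v bipath \<Rightarrow> complex"
  where "T \<equiv> tensor_coeff adj \<phi>"

lemma path_cases_Cons:
  assumes "p \<in> paths adj (length (f # fs))"
  obtains \<alpha> r where "\<alpha> \<in> edges adj" "r \<in> paths adj (length fs)" "last \<alpha> = hd r" "p = \<alpha> \<star> r"
    "\<alpha> \<noteq> []" "r \<noteq> []"
proof -
  have "p \<in> paths adj (1 + length fs)" using assms by simp
  from split_path[OF this] show thesis using that by (metis paths_nonempty)
qed

text \<open>A coefficient is a rectangle with opposite sides \<xi>, \<xi>' and \<open>p\<close>,
  \<open>p'\<close>; it vanishes unless the four corners match. In a nonzero sum some intermediate
  path \<zeta> contributes, and the two rectangles glued along it transmit the corner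
  conditions.\<close>

lemma tensor_coeff_support:
  assumes "fs \<noteq> []" "set fs \<subseteq> F" "p \<in> paths adj (length fs)" "p' \<in> paths adj (length fs)"
    "\<xi> \<in> paths adj n" "\<xi>' \<in> paths adj n" "T fs p p' (\<xi>, \<xi>') \<noteq> 0"
  shows "hd p = hd \<xi> \<and> last p = hd \<xi>' \<and> hd p' = last \<xi> \<and> last p' = last \<xi>'"
  using assms
proof (induction fs arbitrary: p p' \<xi> rule: list_nonempty_induct)
  case (single f)
  then show ?case using support[of f p p' \<xi> n \<xi>'] by auto
next
  case (cons f fs)
  obtain \<alpha> r where r: "\<alpha> \<in> edges adj" "r \<in> paths adj (length fs)" "last \<alpha> = hd r" "p = \<alpha> \<star> r"
    "\<alpha> \<noteq> []" "r \<noteq> []"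
    using path_cases_Cons[OF cons.prems(2)] .
  obtain \<alpha>' r' where r': "\<alpha>' \<in> edges adj" "r' \<in> paths adj (length fs)" "last \<alpha>' = hd r'" "p' = \<alpha>' \<star> r'"
    "\<alpha>' \<noteq> []" "r' \<noteq> []"
    using path_cases_Cons[OF cons.prems(3)] .
  have "(\<Sum>\<zeta>\<in>paths adj n. \<phi> f \<alpha> \<alpha>' (\<xi>, \<zeta>) * T fs r r' (\<zeta>, \<xi>')) \<noteq> 0"
    using tensor_coeff_Cons[OF cons.hyps(1) r(1) r'(1) r(6) r'(6) r(3) r'(3) cons.prems(4), of \<phi> f \<xi>']
      cons.prems(6) r(4) r'(4) by simp
  then obtain \<zeta> where "\<zeta> \<in> paths adj n" "\<phi> f \<alpha> \<alpha>' (\<xi>, \<zeta>) * T fs r r' (\<zeta>, \<xi>') \<noteq> 0"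
    by (rule sum.not_neutral_contains_not_neutral)
  then have \<zeta>: "\<zeta> \<in> paths adj n" "\<phi> f \<alpha> \<alpha>' (\<xi>, \<zeta>) \<noteq> 0" "T fs r r' (\<zeta>, \<xi>') \<noteq> 0"
    by auto
  have "hd r = hd \<zeta> \<and> last r = hd \<xi>' \<and> hd r' = last \<zeta> \<and> last r' = last \<xi>'"
    using cons.IH[OF _ r(2) r'(2) \<zeta>(1) cons.prems(5) \<zeta>(3)] cons.prems(1) by simp
  moreover have "hd \<alpha> = hd \<xi> \<and> last \<alpha> = hd \<zeta> \<and> hd \<alpha>' = last \<xi> \<and> last \<alpha>' = last \<zeta>"
    using support[OF _ r(1) r'(1) cons.prems(4) \<zeta>(1)] \<zeta>(2) cons.prems(1) by auto
  ultimately show ?case using r r' by (simp add: hd_concat_path last_concat_path)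
qed

section \<open>Compatibility of the coefficients with concatenation\<close>

lemma fund_concat:
  assumes f: "f \<in> F" "\<alpha> \<in> edges adj" "\<beta> \<in> edges adj"
    and \<xi>: "\<xi>1 \<in> paths adj m" "\<xi>1' \<in> paths adj m" "\<xi>2 \<in> paths adj n" "\<xi>2' \<in> paths adj n"
      "last \<xi>1 = hd \<xi>2" "last \<xi>1' = hd \<xi>2'"
  shows "\<phi> f \<alpha> \<beta> (\<xi>1 \<star> \<xi>2, \<xi>1' \<star> \<xi>2') =
    (\<Sum>\<gamma>\<in>edges adj. \<phi> f \<alpha> \<gamma> (\<xi>1, \<xi>1') * \<phi> f \<gamma> \<beta> (\<xi>2, \<xi>2'))"
proof -
  let ?c = "[last \<xi>1, last \<xi>1']"
  have z: "\<phi> f \<alpha> \<gamma> (\<xi>1, \<xi>1') = 0" if "\<gamma> \<in> edges adj" "\<gamma> \<noteq> ?c" for \<gamma>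
  proof -
    have "length \<gamma> = 2" using that(1) by (simp add: paths_def)
    then have "\<gamma> = [hd \<gamma>, last \<gamma>]" by (cases \<gamma>; cases "tl \<gamma>") auto
    then have "\<not> (hd \<gamma> = last \<xi>1 \<and> last \<gamma> = last \<xi>1')" using that(2) by metis
    then show ?thesis using support[OF f(1,2) that(1) \<xi>(1,2)] by blast
  qed
  show ?thesis
  proof (cases "adj (last \<xi>1) (last \<xi>1')")
    case True
    then have "?c \<in> edges adj" by (auto simp: paths_def)
    then have "(\<Sum>\<gamma>\<in>edges adj. \<phi> f \<alpha> \<gamma> (\<xi>1, \<xi>1') * \<phi> f \<gamma> \<beta> (\<xi>2, \<xi>2')) =
        (\<Sum>\<gamma>\<in>{?c}. \<phi> f \<alpha> \<gamma> (\<xi>1, \<xi>1') * \<phi> f \<gamma> \<beta> (\<xi>2, \<xi>2'))"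
      by (intro sum.mono_neutral_right) (auto simp: finite_paths z simp del: One_nat_def)
    then show ?thesis using concatenation[OF f \<xi>] True by simp
  next
    case False
    then have "\<gamma> \<noteq> ?c" if "\<gamma> \<in> edges adj" for \<gamma> using that by (auto simp: paths_def)
    then have "(\<Sum>\<gamma>\<in>edges adj. \<phi> f \<alpha> \<gamma> (\<xi>1, \<xi>1') * \<phi> f \<gamma> \<beta> (\<xi>2, \<xi>2')) = 0"
      using z by (intro sum.neutral) (auto simp del: One_nat_def)
    then show ?thesis using concatenation[OF f \<xi>] False by simp
  qed
qed

text \<open>
  In both sides of the induction step the sum may be taken over all quadruples of paths, composable
  or not: the additional terms vanish by the support property.
\<close>

lemma tensor_coeff_concat:
  assumes "fs \<noteq> []" "set fs \<subseteq> F" "p \<in> paths adj (length fs)" "p' \<in> paths adj (length fs)"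
    and \<xi>: "\<xi>1 \<in> paths adj m" "\<xi>1' \<in> paths adj m" "\<xi>2 \<in> paths adj n" "\<xi>2' \<in> paths adj n"
      "last \<xi>1 = hd \<xi>2" "last \<xi>1' = hd \<xi>2'"
  shows "T fs p p' (\<xi>1 \<star> \<xi>2, \<xi>1' \<star> \<xi>2') =
    (\<Sum>c\<in>paths adj (length fs). T fs p c (\<xi>1, \<xi>1') * T fs c p' (\<xi>2, \<xi>2'))"
  using assms
proof (induction fs arbitrary: p p' \<xi>1 \<xi>2 rule: list_nonempty_induct)
  case (single f)
  then show ?case using fund_concat[of f p p' \<xi>1 m \<xi>1' \<xi>2 n \<xi>2'] by simp
next
  case (cons f fs)
  note \<xi> = cons.prems(4-9)
  have F: "f \<in> F" "set fs \<subseteq> F" using cons.prems(1) by auto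
  obtain \<alpha> r where r: "\<alpha> \<in> edges adj" "r \<in> paths adj (length fs)" "last \<alpha> = hd r" "p = \<alpha> \<star> r"
    "\<alpha> \<noteq> []" "r \<noteq> []"
    using path_cases_Cons[OF cons.prems(2)] .
  obtain \<alpha>' r' where r': "\<alpha>' \<in> edges adj" "r' \<in> paths adj (length fs)" "last \<alpha>' = hd r'" "p' = \<alpha>' \<star> r'"
    "\<alpha>' \<noteq> []" "r' \<noteq> []"
    using path_cases_Cons[OF cons.prems(3)] .
  \<comment> \<open>A block of four rectangles: \<gamma> and \<delta> are the inner sides separating
    left from right, \<open>d\<close> and \<open>y\<close> those separating the first factor from
    the remaining ones. Summing the block in either order gives the two sides of the claim.\<close>
  define Q where "Q \<gamma> \<delta> d y = (\<phi> f \<alpha> \<gamma> (\<xi>1, d) * \<phi> f \<gamma> \<alpha>' (\<xi>2, y)) * (T fs r \<delta> (d, \<xi>1') * T fs \<delta> r' (y, \<xi>2'))"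
    for \<gamma> \<delta> d y
  \<comment> \<open>All inner sides meet in the central vertex, so one mismatch there makes some
    factor vanish.\<close>
  have Q0: "Q \<gamma> \<delta> d y = 0"
    if "\<gamma> \<in> edges adj" "\<delta> \<in> paths adj (length fs)" "d \<in> paths adj m" "y \<in> paths adj n"
      "last d \<noteq> hd y \<or> last \<gamma> \<noteq> hd \<delta>" for \<gamma> \<delta> d y
  proof (rule ccontr)
    assume "Q \<gamma> \<delta> d y \<noteq> 0"
    then have nz: "\<phi> f \<alpha> \<gamma> (\<xi>1, d) \<noteq> 0" "\<phi> f \<gamma> \<alpha>' (\<xi>2, y) \<noteq> 0" "T fs r \<delta> (d, \<xi>1') \<noteq> 0"
      by (auto simp: Q_def)
    have "last \<gamma> = last d" using support[OF F(1) r(1) that(1) \<xi>(1) that(3)] nz(1) by blast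
    moreover have "last \<gamma> = hd y" using support[OF F(1) that(1) r'(1) \<xi>(3) that(4)] nz(2) by blast
    moreover have "hd \<delta> = last d"
      using tensor_coeff_support[OF cons.hyps(1) F(2) r(2) that(2,3) \<xi>(2) nz(3)] by blast
    ultimately show False using that(5) by simp
  qed
  let ?L = "paths adj (length fs)"
  have "\<xi>1 \<star> \<xi>2 \<in> paths adj (m + n)" using \<xi> by (intro concat_path_mem)
  then have "T (f # fs) p p' (\<xi>1 \<star> \<xi>2, \<xi>1' \<star> \<xi>2') = (\<Sum>\<zeta>\<in>paths adj (m + n).
      \<phi> f \<alpha> \<alpha>' (\<xi>1 \<star> \<xi>2, \<zeta>) * T fs r r' (\<zeta>, \<xi>1' \<star> \<xi>2'))"
    unfolding r(4) r'(4)
    by (intro tensor_coeff_Cons[OF cons.hyps(1) r(1) r'(1) r(6) r'(6) r(3) r'(3)])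
  also have "\<dots> = (\<Sum>d\<in>paths adj m. \<Sum>y\<in>paths adj n. \<Sum>\<gamma>\<in>edges adj. \<Sum>\<delta>\<in>?L. Q \<gamma> \<delta> d y)"
    unfolding sum_paths_add
  proof (intro sum.cong refl)
    fix d y assume dy: "d \<in> paths adj m" "y \<in> paths adj n"
    show "(if last d = hd y then \<phi> f \<alpha> \<alpha>' (\<xi>1 \<star> \<xi>2, d \<star> y) * T fs r r' (d \<star> y, \<xi>1' \<star> \<xi>2') else 0)
        = (\<Sum>\<gamma>\<in>edges adj. \<Sum>\<delta>\<in>?L. Q \<gamma> \<delta> d y)"
    proof (cases "last d = hd y")
      case True
      show ?thesis
        using fund_concat[OF F(1) r(1) r'(1) \<xi>(1) dy(1) \<xi>(3) dy(2) \<xi>(5) True]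
          cons.IH[OF F(2) r(2) r'(2) dy(1) \<xi>(2) dy(2) \<xi>(4) True \<xi>(6)] True
        by (simp add: Q_def sum_product del: One_nat_def)
    next
      case False
      then have "(\<Sum>\<gamma>\<in>edges adj. \<Sum>\<delta>\<in>?L. Q \<gamma> \<delta> d y) = 0"
        using dy by (intro sum.neutral ballI Q0) auto
      then show ?thesis using False by simp
    qed
  qed
  also have "\<dots> = (\<Sum>\<gamma>\<in>edges adj. \<Sum>\<delta>\<in>?L. \<Sum>d\<in>paths adj m. \<Sum>y\<in>paths adj n. Q \<gamma> \<delta> d y)"
  proof -
    have "(\<Sum>d\<in>paths adj m. \<Sum>y\<in>paths adj n. \<Sum>\<gamma>\<in>edges adj. \<Sum>\<delta>\<in>?L. Q \<gamma> \<delta> d y) =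
      (\<Sum>(d, y)\<in>paths adj m \<times> paths adj n. \<Sum>(\<gamma>, \<delta>)\<in>edges adj \<times> ?L. Q \<gamma> \<delta> d y)"
      by (simp only: sum.cartesian_product[symmetric])
    also have "\<dots> = (\<Sum>(\<gamma>, \<delta>)\<in>edges adj \<times> ?L. \<Sum>(d, y)\<in>paths adj m \<times> paths adj n. Q \<gamma> \<delta> d y)"
      unfolding case_prod_unfold by (rule sum.swap)
    finally show ?thesis by (simp only: sum.cartesian_product[symmetric])
  qed
  also have "\<dots> = (\<Sum>c\<in>paths adj (1 + length fs). T (f # fs) p c (\<xi>1, \<xi>1') * T (f # fs) c p' (\<xi>2, \<xi>2'))"
    unfolding sum_paths_add
  proof (intro sum.cong refl)
    fix \<gamma> \<delta> assume g: "\<gamma> \<in> edges adj" "\<delta> \<in> ?L"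
    have ne: "\<delta> \<noteq> []" using g(2) by (rule paths_nonempty)
    show "(\<Sum>d\<in>paths adj m. \<Sum>y\<in>paths adj n. Q \<gamma> \<delta> d y) = (if last \<gamma> = hd \<delta>
      then T (f # fs) p (\<gamma> \<star> \<delta>) (\<xi>1, \<xi>1') * T (f # fs) (\<gamma> \<star> \<delta>) p' (\<xi>2, \<xi>2') else 0)"
    proof (cases "last \<gamma> = hd \<delta>")
      case True
      show ?thesis
        using tensor_coeff_Cons[OF cons.hyps(1) r(1) g(1) r(6) ne r(3) True \<xi>(1), of \<phi> f \<xi>1']
          tensor_coeff_Cons[OF cons.hyps(1) g(1) r'(1) ne r'(6) True r'(3) \<xi>(3), of \<phi> f \<xi>2'] True
        by (simp add: r(4) r'(4) Q_def sum_product mult_ac)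
    next
      case False
      then have "(\<Sum>d\<in>paths adj m. \<Sum>y\<in>paths adj n. Q \<gamma> \<delta> d y) = 0"
        using g by (intro sum.neutral ballI Q0) auto
      then show ?thesis using False by simp
    qed
  qed
  finally show ?case by simp
qed

text \<open>Two definitions on long paths meet here: \<open>path_ext\<close> multiplies the values
  on edges, while \<open>T\<close> is given on all paths. They agree by splitting off the first
  edge; lengths 0 and 1 are where \<open>path_ext\<close> stops.\<close>

lemma path_ext_tensor_coeff:
  assumes fs: "fs \<noteq> []" "set fs \<subseteq> F" and "p \<in> paths adj (length fs)" "p' \<in> paths adj (length fs)"
    and "\<xi> \<in> paths adj n" "\<xi>' \<in> paths adj n"
  shows "path_ext (paths adj (length fs)) (\<lambda>p p'. lin_ext (T fs p p')) p p' (\<xi>, \<xi>') = T fs p p' (\<xi>, \<xi>')"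
  using assms(3-)
proof (induction n arbitrary: p \<xi> \<xi>')
  case 0
  then obtain v v' where "\<xi> = [v]" "\<xi>' = [v']" by (auto simp: paths_def length_Suc_conv)
  then show ?case by simp
next
  case (Suc n)
  show ?case
  proof (cases n)
    case 0
    then obtain v w v' w' where "\<xi> = [v, w]" "\<xi>' = [v', w']"
      using Suc.prems by (auto simp: paths_def length_Suc_conv)
    then show ?thesis by simp
  next
    case (Suc k)
    have "length \<xi> = Suc (Suc (Suc k))" "length \<xi>' = Suc (Suc (Suc k))"
      using Suc.prems Suc by (auto simp: paths_def)
    then obtain v w u r v' w' u' r' where \<xi>: "\<xi> = v # w # u # r" "\<xi>' = v' # w' # u' # r'"
      by (auto simp: length_Suc_conv)
    have "\<xi> \<in> paths adj (1 + n)" "\<xi>' \<in> paths adj (1 + n)" using Suc.prems by auto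
    note split_path[OF this(1)] split_path[OF this(2)]
    then have e: "[v, w] \<in> paths adj 1" "w # u # r \<in> paths adj n"
      "[v', w'] \<in> paths adj 1" "w' # u' # r' \<in> paths adj n"
      by (simp_all add: \<xi>)
    have "T fs p p' ([v, w] \<star> (w # u # r), [v', w'] \<star> (w' # u' # r')) = (\<Sum>c\<in>paths adj (length fs).
        T fs p c ([v, w], [v', w']) * T fs c p' (w # u # r, w' # u' # r'))"
      by (rule tensor_coeff_concat[OF fs Suc.prems(1,2) e(1,3,2,4)]) simp_all
    then show ?thesis using Suc.IH[OF _ Suc.prems(2) e(2,4)] by (simp add: \<xi> concat_path_def)
  qed
qed

end

section \<open>The essential part as a product in the algebra\<close>

text \<open>The recursion of \<open>path_ext\<close>, carried out in the algebra instead of in a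
  representation. Long pairs need not lie in \<open>EndE\<close>, but their factors do.\<close>

fun path_prod ::
    "('v bipath cvec \<Rightarrow> 'v bipath cvec \<Rightarrow> 'v bipath cvec) \<Rightarrow> 'v bipath \<Rightarrow> 'v bipath cvec"
  where
    "path_prod mul (v # w # u # p, v' # w' # u' # p') =
      mul (basis_vec ([v, w], [v', w'])) (path_prod mul (w # u # p, w' # u' # p'))"
  | "path_prod mul b = basis_vec b"

definition bipaths :: "('v \<Rightarrow> 'v \<Rightarrow> bool) \<Rightarrow> 'v bipath set"
  where "bipaths adj = (\<Union>n. paths adj n \<times> paths adj n)"

lemma matrix_rep_sum:
  assumes S: "matrix_rep A mul one J S" "\<alpha> \<in> J" "\<beta> \<in> J" and A: "cvec.subspace A"
    and a: "\<And>i. i \<in> K \<Longrightarrow> a i \<in> A"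
  shows "S \<alpha> \<beta> (\<Sum>i\<in>K. c i *\<^sub>C a i) = (\<Sum>i\<in>K. c i * S \<alpha> \<beta> (a i))"
proof -
  have lin: "S \<alpha> \<beta> (x + y) = S \<alpha> \<beta> x + S \<alpha> \<beta> y" "S \<alpha> \<beta> (z *\<^sub>C x) = z * S \<alpha> \<beta> x"
    if "x \<in> A" "y \<in> A" for x y z
    using S that by (auto simp: matrix_rep_def)
  have zero: "S \<alpha> \<beta> 0 = 0" using lin(2)[of 0 0 0] cvec.subspace_0[OF A] by simp
  show ?thesis
    using a
  proof (induction K rule: infinite_finite_induct)
    case (insert i K)
    have "(\<Sum>i\<in>K. c i *\<^sub>C a i) \<in> A"
      using insert.prems by (intro cvec.subspace_sum[OF A] cvec.subspace_scale[OF A]) auto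
    moreover have "a i \<in> A" "c i *\<^sub>C a i \<in> A" using insert.prems A by (auto intro: cvec.subspace_scale)
    ultimately show ?case using insert by (simp add: lin)
  qed (auto simp: zero)
qed

lemma path_space_fin_supp: "path_space adj n \<subseteq> (fin_supp :: 'v::finite list cvec set)"
  unfolding fin_supp_def path_space_def
  by (auto intro: finite_subset[OF _ finite_paths])

lemma essential_path_space: "essential adj \<mu> n \<subseteq> path_space adj n"
  by (auto simp: essential_def)

lemma basis_vec_path_space: "p \<in> paths adj n \<Longrightarrow> basis_vec p \<in> path_space adj n"
  by (auto simp: path_space_def basis_vec_def split: if_splits)

text \<open>For \<open>k \<ge> 1\<close> the operator \<open>cap\<close> acts only on lengths
  greater than \<open>k\<close>, so it kills vertices and edges. This puts the factors of
  \<open>path_prod\<close> into the algebra.\<close>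

lemma basis_vec_essential:
  assumes "p \<in> paths adj n" "n \<le> 1"
  shows "basis_vec p \<in> essential adj \<mu> n"
proof -
  have "cap_basis \<mu> k p = 0" if "k \<ge> 1" for k
    using assms that by (auto simp: cap_basis_def paths_def)
  then show ?thesis
    using basis_vec_path_space[OF assms(1)]
    by (simp add: essential_def cap_def zero_fun_def)
qed

lemma EndE_fin_supp: "EndE adj \<mu> \<subseteq> (fin_supp :: 'v::finite bipath cvec set)"
  unfolding EndE_def
proof (intro cvec.span_minimal subspace_fin_supp subsetI)
  fix t
  assume "t \<in> {\<xi> \<otimes>\<^sub>v \<xi>' |\<xi> \<xi>' n. \<xi> \<in> essential adj \<mu> n \<and> \<xi>' \<in> essential adj \<mu> n}"
  then obtain \<xi> \<xi>' n where "t = \<xi> \<otimes>\<^sub>v \<xi>'" "\<xi> \<in> essential adj \<mu> n" "\<xi>' \<in> essential adj \<mu> n"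
    by blast
  then show "t \<in> fin_supp"
    using essential_path_space[of adj \<mu> n] path_space_fin_supp[of adj n]
    by (metis subsetD tensor_fin_supp)
qed

lemma EndE_tensor_mem:
  "\<xi> \<in> essential adj \<mu> n \<Longrightarrow> \<xi>' \<in> essential adj \<mu> n \<Longrightarrow> \<xi> \<otimes>\<^sub>v \<xi>' \<in> EndE adj \<mu>"
  unfolding EndE_def by (rule cvec.span_base) blast

lemma lin_ext_tensor_paths:
  fixes \<xi> \<xi>' :: "'v::finite list cvec"
  assumes "\<xi> \<in> path_space adj n" "\<xi>' \<in> path_space adj m"
  shows "lin_ext \<theta> (\<xi> \<otimes>\<^sub>v \<xi>') = (\<Sum>x\<in>paths adj n. \<Sum>y\<in>paths adj m. \<xi> x * \<xi>' y * \<theta> (x, y))"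
proof -
  have "lin_ext \<theta> (\<xi> \<otimes>\<^sub>v \<xi>') = (\<Sum>r\<in>paths adj n \<times> paths adj m. (\<xi> \<otimes>\<^sub>v \<xi>') r * \<theta> r)"
    using assms by (intro lin_ext_eq_sum) (auto simp: path_space_def finite_paths)
  then show ?thesis by (simp add: sum.cartesian_product case_prod_unfold tensor_def)
qed

context double_triangle_algebra
begin

lemma basis_vec_mem:
  assumes "\<xi> \<in> paths adj n" "\<xi>' \<in> paths adj n" "n \<le> 1"
  shows "basis_vec (\<xi>, \<xi>') \<in> EndE adj \<mu>"
  using EndE_tensor_mem[OF basis_vec_essential[OF assms(1,3)] basis_vec_essential[OF assms(2,3)]]
  by (simp add: tensor_basis_vec)

text \<open>Membership and value are proved in one induction, because multiplicativity of
  \<open>S\<close> is available only for elements of the algebra.\<close>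

lemma path_prod_rep:
  assumes "\<xi> \<in> paths adj n" "\<xi>' \<in> paths adj n"
  shows "path_prod mul (\<xi>, \<xi>') \<in> EndE adj \<mu>"
    and "matrix_rep (EndE adj \<mu>) mul one J S \<Longrightarrow> \<alpha> \<in> J \<Longrightarrow> \<beta> \<in> J
      \<Longrightarrow> S \<alpha> \<beta> (path_prod mul (\<xi>, \<xi>')) = path_ext J S \<alpha> \<beta> (\<xi>, \<xi>')"
proof -
  have "path_prod mul (\<xi>, \<xi>') \<in> EndE adj \<mu> \<and> (matrix_rep (EndE adj \<mu>) mul one J S \<longrightarrow>
    (\<forall>\<alpha>\<in>J. \<forall>\<beta>\<in>J. S \<alpha> \<beta> (path_prod mul (\<xi>, \<xi>')) = path_ext J S \<alpha> \<beta> (\<xi>, \<xi>')))"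
    using assms
  proof (induction n arbitrary: \<xi> \<xi>')
    case 0
    then obtain v v' where "\<xi> = [v]" "\<xi>' = [v']" by (auto simp: paths_def length_Suc_conv)
    then show ?case using basis_vec_mem[of \<xi> 0 \<xi>'] 0 by simp
  next
    case (Suc n)
    show ?case
    proof (cases n)
      case 0
      then obtain v w v' w' where "\<xi> = [v, w]" "\<xi>' = [v', w']"
        using Suc.prems by (auto simp: paths_def length_Suc_conv)
      then show ?thesis using basis_vec_mem[of \<xi> 1 \<xi>'] Suc.prems 0 by simp
    next
      case (Suc k)
      have "length \<xi> = Suc (Suc (Suc k))" "length \<xi>' = Suc (Suc (Suc k))"
        using Suc.prems Suc by (auto simp: paths_def)
      then obtain v w u r v' w' u' r' where \<xi>: "\<xi> = v # w # u # r" "\<xi>' = v' # w' # u' # r'"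
        by (auto simp: length_Suc_conv)
      have "\<xi> \<in> paths adj (1 + n)" "\<xi>' \<in> paths adj (1 + n)" using Suc.prems by auto
      note split_path[OF this(1)] split_path[OF this(2)]
      then have e: "[v, w] \<in> paths adj 1" "w # u # r \<in> paths adj n"
        "[v', w'] \<in> paths adj 1" "w' # u' # r' \<in> paths adj n"
        by (simp_all add: \<xi>)
      note IH = Suc.IH[OF e(2,4)]
      have m: "basis_vec ([v, w], [v', w']) \<in> EndE adj \<mu>" using basis_vec_mem[OF e(1,3)] by simp
      show ?thesis
      proof (intro conjI impI ballI)
        show "path_prod mul (\<xi>, \<xi>') \<in> EndE adj \<mu>"
          using IH m by (simp add: \<xi> mult_closed)
        fix \<alpha> \<beta> assume S: "matrix_rep (EndE adj \<mu>) mul one J S" "\<alpha> \<in> J" "\<beta> \<in> J"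
        then have "S \<alpha> \<beta> (path_prod mul (\<xi>, \<xi>')) = (\<Sum>\<gamma>\<in>J. S \<alpha> \<gamma> (basis_vec ([v, w], [v', w'])) *
            S \<gamma> \<beta> (path_prod mul (w # u # r, w' # u' # r')))"
          using IH m by (simp add: \<xi> matrix_rep_def)
        also have "\<dots> = path_ext J S \<alpha> \<beta> (\<xi>, \<xi>')"
          using IH S by (simp add: \<xi>)
        finally show "S \<alpha> \<beta> (path_prod mul (\<xi>, \<xi>')) = path_ext J S \<alpha> \<beta> (\<xi>, \<xi>')" .
      qed
    qed
  qed
  then show "path_prod mul (\<xi>, \<xi>') \<in> EndE adj \<mu>"
    and "matrix_rep (EndE adj \<mu>) mul one J S \<Longrightarrow> \<alpha> \<in> J \<Longrightarrow> \<beta> \<in> J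
      \<Longrightarrow> S \<alpha> \<beta> (path_prod mul (\<xi>, \<xi>')) = path_ext J S \<alpha> \<beta> (\<xi>, \<xi>')"
    by auto
qed

definition T_family :: "('v bipath \<Rightarrow> complex) set"
  where "T_family = {T fs p p' | fs p p'. fs \<noteq> [] \<and> set fs \<subseteq> F \<and>
    p \<in> paths adj (length fs) \<and> p' \<in> paths adj (length fs)}"

lemma separating_T_family: "separating T_family (EndE adj \<mu>)"
  unfolding separating_def
proof (intro ballI impI)
  fix a assume a: "a \<in> EndE adj \<mu>" and z: "\<forall>\<theta>\<in>T_family. lin_ext \<theta> a = 0"
  show "a = 0"
  proof (rule star_reps_separate[where K = "{fs. fs \<noteq> [] \<and> set fs \<subseteq> F}"
        and J = "\<lambda>fs. paths adj (length fs)" and S = "\<lambda>fs p p'. lin_ext (T fs p p')"])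
    show "lin_ext (T fs p p') a = 0" if "fs \<in> {fs. fs \<noteq> [] \<and> set fs \<subseteq> F}"
      "p \<in> paths adj (length fs)" "p' \<in> paths adj (length fs)" for fs p p'
      using z that by (auto simp: T_family_def)
  qed (use a tensor_star_rep irreps_occur in auto)
qed

text \<open>Summing over intermediate paths enforces the composability of the matrix indices.\<close>

lemma sum_tensor_coeff:
  assumes fs: "fs \<noteq> []" "set fs \<subseteq> F" "p \<in> paths adj (length fs)" "p' \<in> paths adj (length fs)"
    and gs: "gs \<noteq> []" "set gs \<subseteq> F" "q \<in> paths adj (length gs)" "q' \<in> paths adj (length gs)"
    and \<xi>: "\<xi> \<in> path_space adj n" "\<xi>' \<in> path_space adj n"
  shows "(\<Sum>\<zeta>\<in>paths adj n. lin_ext (T fs p p') (\<xi> \<otimes>\<^sub>v basis_vec \<zeta>) * lin_ext (T gs q q') (basis_vec \<zeta> \<otimes>\<^sub>v \<xi>'))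
    = (if last p = hd q \<and> last p' = hd q' then lin_ext (T (fs @ gs) (p \<star> q) (p' \<star> q')) (\<xi> \<otimes>\<^sub>v \<xi>') else 0)"
proof -
  let ?P = "paths adj n"
  have b: "(\<Sum>y\<in>?P. basis_vec \<zeta> y * g y) = g \<zeta>" if "\<zeta> \<in> ?P" for \<zeta> and g :: "'v list \<Rightarrow> complex"
    using that by (simp add: basis_vec_def if_distrib[of "\<lambda>c. c * _"] finite_paths cong: if_cong)
  have "lin_ext (T fs p p') (\<xi> \<otimes>\<^sub>v basis_vec \<zeta>) = (\<Sum>x\<in>?P. \<xi> x * T fs p p' (x, \<zeta>))"
    "lin_ext (T gs q q') (basis_vec \<zeta> \<otimes>\<^sub>v \<xi>') = (\<Sum>y\<in>?P. \<xi>' y * T gs q q' (\<zeta>, y))" if \<zeta>: "\<zeta> \<in> ?P" for \<zeta>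
  proof -
    show "lin_ext (T fs p p') (\<xi> \<otimes>\<^sub>v basis_vec \<zeta>) = (\<Sum>x\<in>?P. \<xi> x * T fs p p' (x, \<zeta>))"
      using b[OF \<zeta>]
      by (simp add: lin_ext_tensor_paths[OF \<xi>(1) basis_vec_path_space[OF \<zeta>]] mult.assoc
          flip: sum_distrib_left)
    show "lin_ext (T gs q q') (basis_vec \<zeta> \<otimes>\<^sub>v \<xi>') = (\<Sum>y\<in>?P. \<xi>' y * T gs q q' (\<zeta>, y))"
      using b[OF \<zeta>]
      by (simp add: lin_ext_tensor_paths[OF basis_vec_path_space[OF \<zeta>] \<xi>(2)] mult.assoc
          flip: sum_distrib_left)
  qed
  then have "(\<Sum>\<zeta>\<in>?P. lin_ext (T fs p p') (\<xi> \<otimes>\<^sub>v basis_vec \<zeta>) * lin_ext (T gs q q') (basis_vec \<zeta> \<otimes>\<^sub>v \<xi>'))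
    = (\<Sum>\<zeta>\<in>?P. \<Sum>x\<in>?P. \<Sum>y\<in>?P. \<xi> x * \<xi>' y * (T fs p p' (x, \<zeta>) * T gs q q' (\<zeta>, y)))"
    by (simp add: sum_product mult_ac)
  also have "\<dots> = (\<Sum>x\<in>?P. \<Sum>\<zeta>\<in>?P. \<Sum>y\<in>?P. \<xi> x * \<xi>' y * (T fs p p' (x, \<zeta>) * T gs q q' (\<zeta>, y)))"
    by (rule sum.swap)
  also have "\<dots> = (\<Sum>x\<in>?P. \<Sum>y\<in>?P. \<Sum>\<zeta>\<in>?P. \<xi> x * \<xi>' y * (T fs p p' (x, \<zeta>) * T gs q q' (\<zeta>, y)))"
    by (rule sum.cong[OF refl], rule sum.swap)
  also have "\<dots> = (\<Sum>x\<in>?P. \<Sum>y\<in>?P. \<xi> x * \<xi>' y * (\<Sum>\<zeta>\<in>?P. T fs p p' (x, \<zeta>) * T gs q q' (\<zeta>, y)))"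
    by (simp add: sum_distrib_left)
  also have "\<dots> = (if last p = hd q \<and> last p' = hd q'
    then lin_ext (T (fs @ gs) (p \<star> q) (p' \<star> q')) (\<xi> \<otimes>\<^sub>v \<xi>') else 0)"
  proof (cases "last p = hd q \<and> last p' = hd q'")
    case True
    then show ?thesis
      using tensor_coeff_append[OF fs(1) gs(1) fs(3,4) paths_nonempty[OF gs(3)] paths_nonempty[OF gs(4)]]
      by (simp add: lin_ext_tensor_paths[OF \<xi>])
  next
    case False
    \<comment> \<open>If both factors were nonzero, then \<open>last p = hd \<zeta> = hd q\<close>
      and \<open>last p' = last \<zeta> = hd q'\<close>.\<close>
    have "T fs p p' (x, \<zeta>) * T gs q q' (\<zeta>, y) = 0" if "x \<in> ?P" "y \<in> ?P" "\<zeta> \<in> ?P" for x y \<zeta>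
      using tensor_coeff_support[OF fs that(1,3)] tensor_coeff_support[OF gs that(3,2)] False
      by (metis mult_eq_0_iff)
    then have "(\<Sum>\<zeta>\<in>?P. T fs p p' (x, \<zeta>) * T gs q q' (\<zeta>, y)) = 0" if "x \<in> ?P" "y \<in> ?P" for x y
      using that by (intro sum.neutral ballI)
    then have "(\<Sum>x\<in>?P. \<Sum>y\<in>?P. \<xi> x * \<xi>' y * (\<Sum>\<zeta>\<in>?P. T fs p p' (x, \<zeta>) * T gs q q' (\<zeta>, y))) = 0"
      by (simp add: sum.neutral)
    then show ?thesis using False by auto
  qed
  finally show ?thesis .
qed

end

section \<open>Values of representations on the essential part\<close>

locale dta_irreps =
  double_triangle_algebra adj \<mu> mul one star F \<phi> +
  irreps: irrep_system "EndE adj \<mu>" mul one star X I R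
  for adj :: "'v::finite \<Rightarrow> 'v \<Rightarrow> bool" and \<mu> mul one star and F :: "'f set" and \<phi>
    and X :: "'x set" and I :: "'x \<Rightarrow> 'i set" and R +
  fixes E :: "'x \<Rightarrow> 'i \<Rightarrow> 'i \<Rightarrow> 'v bipath cvec"
  assumes units: "matrix_units (EndE adj \<mu>) X I R E"
begin

lemma unit_mem: "x \<in> X \<Longrightarrow> \<alpha> \<in> I x \<Longrightarrow> \<beta> \<in> I x \<Longrightarrow> E x \<alpha> \<beta> \<in> EndE adj \<mu>"
  using units by (auto simp: matrix_units_def)

lemma essential_part_mem: "essential_part X I R E t \<in> EndE adj \<mu>"
  unfolding essential_part_def
  by (intro cvec.subspace_sum[OF subspace] cvec.subspace_scale[OF subspace] unit_mem)

lemma irrep: "x \<in> X \<Longrightarrow> matrix_rep (EndE adj \<mu>) mul one (I x) (R x)"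
  using irreps.star_rep by (simp add: matrix_star_rep_def)

lemma irrep_essential_part:
  assumes "y \<in> X" "\<eta> \<in> I y" "\<eta>' \<in> I y"
  shows "R y \<eta> \<eta>' (essential_part X I R E t) = lin_ext (path_ext (I y) (R y) \<eta> \<eta>') t"
proof -
  have fin: "finite (I x)" if "x \<in> X" for x using irrep[OF that] by (simp add: matrix_rep_def)
  \<comment> \<open>Flattening the triple sum lets a single Kronecker delta select the term.\<close>
  let ?Z = "SIGMA x:X. I x \<times> I x"
  let ?c = "\<lambda>(x, \<alpha>, \<beta>). lin_ext (path_ext (I x) (R x) \<alpha> \<beta>) t"
  have "essential_part X I R E t = (\<Sum>z\<in>?Z. ?c z *\<^sub>C (case z of (x, \<alpha>, \<beta>) \<Rightarrow> E x \<alpha> \<beta>))"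
    unfolding essential_part_def
    using irreps.finite_irreps fin
    by (simp add: sum.Sigma sum.cartesian_product case_prod_unfold)
  then have "R y \<eta> \<eta>' (essential_part X I R E t) =
      (\<Sum>z\<in>?Z. ?c z * R y \<eta> \<eta>' (case z of (x, \<alpha>, \<beta>) \<Rightarrow> E x \<alpha> \<beta>))"
    using unit_mem
    by (simp only:) (rule matrix_rep_sum[OF irrep[OF assms(1)] assms(2,3) subspace], auto)
  also have "\<dots> = (\<Sum>z\<in>?Z. ?c z * of_bool (z = (y, \<eta>, \<eta>')))"
    using units assms by (intro sum.cong refl) (auto simp: matrix_units_def)
  also have "\<dots> = (\<Sum>z\<in>?Z. if z = (y, \<eta>, \<eta>') then ?c z else 0)"
    by (intro sum.cong) auto
  also have "\<dots> = ?c (y, \<eta>, \<eta>')"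
    using irreps.finite_irreps fin assms by (subst sum.delta) auto
  finally show ?thesis by simp
qed

text \<open>Both sides have the same coefficients in every \<open>R y\<close>, and these separate
  the algebra. The right-hand side no longer mentions irreducible representations, so any
  representation can be applied to it.\<close>

lemma essential_part_eq:
  assumes t: "t \<in> fin_supp" "{b. t b \<noteq> 0} \<subseteq> bipaths adj"
  shows "essential_part X I R E t = (\<Sum>b | t b \<noteq> 0. t b *\<^sub>C path_prod mul b)" (is "_ = ?u")
proof -
  have pm: "path_prod mul b \<in> EndE adj \<mu>" if "t b \<noteq> 0" for b
    using t(2) that path_prod_rep(1) by (auto simp: bipaths_def)
  have uA: "?u \<in> EndE adj \<mu>"
    using pm by (intro cvec.subspace_sum[OF subspace] cvec.subspace_scale[OF subspace]) auto
  have "R y \<eta> \<eta>' ?u = lin_ext (path_ext (I y) (R y) \<eta> \<eta>') t"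
    if "y \<in> X" "\<eta> \<in> I y" "\<eta>' \<in> I y" for y \<eta> \<eta>'
  proof -
    have "R y \<eta> \<eta>' ?u = (\<Sum>b | t b \<noteq> 0. t b * R y \<eta> \<eta>' (path_prod mul b))"
      by (rule matrix_rep_sum[OF irrep[OF that(1)] that(2,3) subspace]) (simp add: pm)
    also have "\<dots> = lin_ext (path_ext (I y) (R y) \<eta> \<eta>') t"
      unfolding lin_ext_def
      using t(2) path_prod_rep(2)[OF _ _ irrep[OF that(1)] that(2,3)]
      by (intro sum.cong refl) (auto simp: bipaths_def)
    finally show ?thesis .
  qed
  note ru = this
  let ?d = "essential_part X I R E t + (-1) *\<^sub>C ?u"
  have "?d = 0"
  proof (rule star_reps_separate[where K = X and J = I and S = R])
    show "?d \<in> EndE adj \<mu>"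
      by (intro cvec.subspace_add[OF subspace] cvec.subspace_scale[OF subspace] uA essential_part_mem)
    show "R y \<eta> \<eta>' ?d = 0" if y: "y \<in> X" "\<eta> \<in> I y" "\<eta>' \<in> I y" for y \<eta> \<eta>'
    proof -
      \<comment> \<open>The Boolean index set turns the lemma on finite sums into linearity for one
        difference.\<close>
      have "R y \<eta> \<eta>' ?d = R y \<eta> \<eta>' (essential_part X I R E t) + (-1) * R y \<eta> \<eta>' ?u"
        using matrix_rep_sum[OF irrep[OF y(1)] y(2,3) subspace, where K = "{True, False}"
            and a = "\<lambda>i. if i then essential_part X I R E t else ?u" and c = "\<lambda>i. if i then 1 else -1"]
          uA essential_part_mem[of t]
        by simp
      then show ?thesis using ru[OF y] irrep_essential_part[OF y] by simp
    qed
    \<comment> \<open>An equivalence is in particular an embedding with an equivariant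
      retraction.\<close>
    show "\<exists>x\<in>X. occurs_in (EndE adj \<mu>) {..<d} S (I x) (R x)"
      if "matrix_rep (EndE adj \<mu>) mul one {..<d} S" "irreducible_rep (EndE adj \<mu>) {..<d} S" for d :: nat and S
      using irreps.complete[OF that] unfolding equivalent_reps_def occurs_in_def by blast
  qed (rule irreps.star_rep)
  then show ?thesis by simp
qed

text \<open>Multiplicativity turns each \<open>path_prod\<close> into a \<open>path_ext\<close>, and
  concatenation turns that back into the coefficient on the original pair of paths.\<close>

lemma tensor_coeff_essential_part:
  assumes fs: "fs \<noteq> []" "set fs \<subseteq> F" "p \<in> paths adj (length fs)" "p' \<in> paths adj (length fs)"
    and t: "t \<in> fin_supp" "{b. t b \<noteq> 0} \<subseteq> bipaths adj"
  shows "lin_ext (T fs p p') (essential_part X I R E t) = lin_ext (T fs p p') t"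
proof -
  let ?S = "\<lambda>p p'. lin_ext (T fs p p')" and ?J = "paths adj (length fs)"
  have S: "matrix_rep (EndE adj \<mu>) mul one ?J ?S"
    using tensor_star_rep[OF fs(1,2)] by (simp add: matrix_star_rep_def)
  have "?S p p' (essential_part X I R E t) = (\<Sum>b | t b \<noteq> 0. t b * ?S p p' (path_prod mul b))"
    unfolding essential_part_eq[OF t]
    using t(2) path_prod_rep(1)
    by (intro matrix_rep_sum[OF S fs(3,4) subspace]) (auto simp: bipaths_def)
  also have "\<dots> = lin_ext (T fs p p') t"
    unfolding lin_ext_def[of _ t]
    using t(2) path_prod_rep(2)[OF _ _ S fs(3,4)] path_ext_tensor_coeff[OF fs]
    by (intro sum.cong refl) (auto simp: bipaths_def)
  finally show ?thesis .
qed

end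

section \<open>The coproduct\<close>

locale dta_coproduct = dta_irreps adj \<mu> mul one star F \<phi> X I R E
  for adj :: "'v::finite \<Rightarrow> 'v \<Rightarrow> bool" and \<mu> mul one star and F :: "'f set" and \<phi>
    and X :: "'x set" and I :: "'x \<Rightarrow> 'i set" and R E +
  fixes \<Delta> :: "'v bipath cvec \<Rightarrow> ('v bipath \<times> 'v bipath) cvec"
  assumes \<Delta>_linear: "clinear_on (EndE adj \<mu>) (tensor_space (EndE adj \<mu>) (EndE adj \<mu>)) \<Delta>"
    and \<Delta>_essential: "\<xi> \<in> essential adj \<mu> n \<Longrightarrow> \<xi>' \<in> essential adj \<mu> n \<Longrightarrow>
      \<Delta> (\<xi> \<otimes>\<^sub>v \<xi>') = (\<Sum>\<zeta>\<in>paths adj n.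
        essential_part X I R E (\<xi> \<otimes>\<^sub>v basis_vec \<zeta>) \<otimes>\<^sub>v essential_part X I R E (basis_vec \<zeta> \<otimes>\<^sub>v \<xi>'))"
begin

abbreviation A :: "'v bipath cvec set"
  where "A \<equiv> EndE adj \<mu>"

abbreviation rep_index :: "'f list \<Rightarrow> 'v list \<Rightarrow> 'v list \<Rightarrow> bool"
  where "rep_index fs p p' \<equiv> fs \<noteq> [] \<and> set fs \<subseteq> F \<and> p \<in> paths adj (length fs) \<and> p' \<in> paths adj (length fs)"

lemmas \<Delta>_mem = clinear_onD(1)[OF \<Delta>_linear]
  and \<Delta>_add = clinear_onD(2)[OF \<Delta>_linear]
  and \<Delta>_scale = clinear_onD(3)[OF \<Delta>_linear]

lemma A_fin_supp: "a \<in> A \<Longrightarrow> a \<in> fin_supp"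
  using EndE_fin_supp by blast

lemma AA_fin_supp: "t \<in> tensor_space A A \<Longrightarrow> t \<in> fin_supp"
  using tensor_space_fin_supp[OF EndE_fin_supp EndE_fin_supp] by blast

text \<open>The elementary paths \<zeta> are in general not essential, which is why \<Delta>
  contains essential parts; the coefficients do not see the difference.\<close>

lemma \<Delta>_essential_eval:
  assumes fs: "rep_index fs p p'" and gs: "rep_index gs q q'"
    and \<xi>: "\<xi> \<in> essential adj \<mu> n" "\<xi>' \<in> essential adj \<mu> n"
  shows "lin_ext (T fs p p' \<otimes>\<^sub>v T gs q q') (\<Delta> (\<xi> \<otimes>\<^sub>v \<xi>')) =
    (\<Sum>\<zeta>\<in>paths adj n. lin_ext (T fs p p') (\<xi> \<otimes>\<^sub>v basis_vec \<zeta>) * lin_ext (T gs q q') (basis_vec \<zeta> \<otimes>\<^sub>v \<xi>'))"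
proof -
  let ?e = "essential_part X I R E"
  have \<xi>P: "\<xi> \<in> path_space adj n" "\<xi>' \<in> path_space adj n"
    using \<xi> essential_path_space by blast+
  have ef: "?e t \<in> fin_supp" for t using essential_part_mem A_fin_supp by blast
  have "lin_ext (T fs p p' \<otimes>\<^sub>v T gs q q') (\<Delta> (\<xi> \<otimes>\<^sub>v \<xi>')) = (\<Sum>\<zeta>\<in>paths adj n.
    lin_ext (T fs p p') (?e (\<xi> \<otimes>\<^sub>v basis_vec \<zeta>)) * lin_ext (T gs q q') (?e (basis_vec \<zeta> \<otimes>\<^sub>v \<xi>')))"
    unfolding \<Delta>_essential[OF \<xi>]
    by (simp add: lin_ext_sum tensor_fin_supp ef lin_ext_tensor_tensor)
  also have "\<dots> = (\<Sum>\<zeta>\<in>paths adj n. lin_ext (T fs p p') (\<xi> \<otimes>\<^sub>v basis_vec \<zeta>) *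
    lin_ext (T gs q q') (basis_vec \<zeta> \<otimes>\<^sub>v \<xi>'))"
  proof (rule sum.cong[OF refl])
    fix \<zeta> assume "\<zeta> \<in> paths adj n"
    then have b: "basis_vec \<zeta> \<in> path_space adj n" by (rule basis_vec_path_space)
    have gr: "x \<otimes>\<^sub>v y \<in> fin_supp" "{b. (x \<otimes>\<^sub>v y) b \<noteq> 0} \<subseteq> bipaths adj"
      if "x \<in> path_space adj n" "y \<in> path_space adj n" for x y
    proof -
      show "x \<otimes>\<^sub>v y \<in> fin_supp"
        using that path_space_fin_supp[of adj n] by (intro tensor_fin_supp) blast+
      have "x p = 0 \<or> p \<in> paths adj n" "y p = 0 \<or> p \<in> paths adj n" for p
        using that by (auto simp: path_space_def)
      then show "{b. (x \<otimes>\<^sub>v y) b \<noteq> 0} \<subseteq> bipaths adj"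
        unfolding bipaths_def by (clarsimp simp: tensor_def) blast
    qed
    show "lin_ext (T fs p p') (?e (\<xi> \<otimes>\<^sub>v basis_vec \<zeta>)) * lin_ext (T gs q q') (?e (basis_vec \<zeta> \<otimes>\<^sub>v \<xi>')) =
      lin_ext (T fs p p') (\<xi> \<otimes>\<^sub>v basis_vec \<zeta>) * lin_ext (T gs q q') (basis_vec \<zeta> \<otimes>\<^sub>v \<xi>')"
      using fs gs by (simp add: tensor_coeff_essential_part gr b \<xi>P)
  qed
  finally show ?thesis .
qed

text \<open>Both sides are linear in \<open>a\<close>, so it suffices to compare them on the
  spanning tensors. Coassociativity, multiplicativity and the star property use only this formula
  and that \<Delta> is linear with values in A \<otimes> A.\<close>

lemma \<Delta>_eval:
  assumes fs: "rep_index fs p p'" and gs: "rep_index gs q q'" and a: "a \<in> A"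
  shows "lin_ext (T fs p p' \<otimes>\<^sub>v T gs q q') (\<Delta> a) =
    (if last p = hd q \<and> last p' = hd q' then lin_ext (T (fs @ gs) (p \<star> q) (p' \<star> q')) a else 0)"
proof -
  define L where "L a = lin_ext (T fs p p' \<otimes>\<^sub>v T gs q q') (\<Delta> a)" for a
  define M where "M a = (if last p = hd q \<and> last p' = hd q' then lin_ext (T (fs @ gs) (p \<star> q) (p' \<star> q')) a else 0)" for a
  have "cvec.subspace {a\<in>A. L a = M a}"
  proof (rule cvec.subspaceI)
    show "0 \<in> {a\<in>A. L a = M a}"
      using cvec.subspace_0[OF subspace] \<Delta>_scale[of 0 0] by (simp add: L_def M_def)
  qed (use subspace in \<open>auto simp: L_def M_def \<Delta>_add \<Delta>_scale lin_ext_add lin_ext_scale A_fin_supp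
      AA_fin_supp \<Delta>_mem cvec.subspace_add cvec.subspace_scale\<close>)
  moreover have "{\<xi> \<otimes>\<^sub>v \<xi>' |\<xi> \<xi>' n. \<xi> \<in> essential adj \<mu> n \<and> \<xi>' \<in> essential adj \<mu> n} \<subseteq> {a\<in>A. L a = M a}"
  proof clarify
    fix \<xi> \<xi>' n assume \<xi>: "\<xi> \<in> essential adj \<mu> n" "\<xi>' \<in> essential adj \<mu> n"
    then have "\<xi> \<in> path_space adj n" "\<xi>' \<in> path_space adj n"
      using essential_path_space by blast+
    then show "\<xi> \<otimes>\<^sub>v \<xi>' \<in> A \<and> L (\<xi> \<otimes>\<^sub>v \<xi>') = M (\<xi> \<otimes>\<^sub>v \<xi>')"
      unfolding L_def M_def \<Delta>_essential_eval[OF fs gs \<xi>]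
      using fs gs \<xi> by (simp add: EndE_tensor_mem sum_tensor_coeff)
  qed
  ultimately have "A \<subseteq> {a\<in>A. L a = M a}"
    by (subst EndE_def) (rule cvec.span_minimal)
  then show ?thesis using a by (auto simp: L_def M_def)
qed

lemma rep_index_append:
  assumes "rep_index fs p p'" "rep_index gs q q'" "last p = hd q" "last p' = hd q'"
  shows "rep_index (fs @ gs) (p \<star> q) (p' \<star> q')"
  using assms by (auto intro: concat_path_mem)

lemma separating_AA:
  "separating {\<theta> \<otimes>\<^sub>v \<psi> |\<theta> \<psi>. \<theta> \<in> T_family \<and> \<psi> \<in> T_family} (tensor_space A A)"
  by (rule separating_tensor[OF subspace EndE_fin_supp subspace EndE_fin_supp
        separating_T_family separating_T_family])

lemma AA_eqI:
  assumes "s \<in> tensor_space A A" "t \<in> tensor_space A A"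
    and "\<And>fs p p' gs q q'. rep_index fs p p' \<Longrightarrow> rep_index gs q q' \<Longrightarrow>
      lin_ext (T fs p p' \<otimes>\<^sub>v T gs q q') s = lin_ext (T fs p p' \<otimes>\<^sub>v T gs q q') t"
  shows "s = t"
proof (rule separatingD[OF separating_AA subspace_tensor_space _ assms(1,2)])
  show "tensor_space A A \<subseteq> fin_supp" using AA_fin_supp by blast
qed (use assms(3) in \<open>auto simp: T_family_def\<close>)

lemma AAA_eqI:
  assumes "s \<in> tensor_space (tensor_space A A) A" "t \<in> tensor_space (tensor_space A A) A"
    and "\<And>fs p p' gs q q' hs r r'. rep_index fs p p' \<Longrightarrow> rep_index gs q q' \<Longrightarrow> rep_index hs r r' \<Longrightarrow>
      lin_ext ((T fs p p' \<otimes>\<^sub>v T gs q q') \<otimes>\<^sub>v T hs r r') s =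
      lin_ext ((T fs p p' \<otimes>\<^sub>v T gs q q') \<otimes>\<^sub>v T hs r r') t"
  shows "s = t"
proof (rule separatingD[OF separating_tensor[OF subspace_tensor_space _ subspace EndE_fin_supp
        separating_AA separating_T_family] subspace_tensor_space _ assms(1,2)])
  show AA: "tensor_space A A \<subseteq> fin_supp" using AA_fin_supp by blast
  show "tensor_space (tensor_space A A) A \<subseteq> fin_supp"
    by (rule tensor_space_fin_supp[OF AA EndE_fin_supp])
qed (use assms(3) in \<open>force simp: T_family_def\<close>)

section \<open>Coassociativity\<close>

lemma \<Delta>_sumE:
  assumes "a \<in> A"
  obtains m b c where "\<And>i. i < m \<Longrightarrow> b i \<in> A" "\<And>i. i < m \<Longrightarrow> c i \<in> A"
    "\<Delta> a = (\<Sum>i<m::nat. b i \<otimes>\<^sub>v c i)"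
  using tensor_space_sumE[OF subspace \<Delta>_mem[OF assms]] by blast

text \<open>Either bracketing evaluates to the coefficient of \<open>fs @ gs @ hs\<close> at the
  threefold concatenations, or to 0 if a junction fails.\<close>

lemma \<Delta>_coassoc:
  assumes a: "a \<in> A"
  shows "tensor_map A A \<Delta> (\<lambda>b. b) (\<Delta> a) = reassoc (tensor_map A A (\<lambda>b. b) \<Delta> (\<Delta> a))"
proof -
  obtain m b c where bc: "\<And>i. i < m \<Longrightarrow> b i \<in> A" "\<And>i. i < m \<Longrightarrow> c i \<in> A"
    and \<Delta>a: "\<Delta> a = (\<Sum>i<m::nat. b i \<otimes>\<^sub>v c i)"
    using \<Delta>_sumE[OF a] by blast
  let ?l = "\<Sum>i<m. \<Delta> (b i) \<otimes>\<^sub>v c i" and ?r = "\<Sum>i<m. b i \<otimes>\<^sub>v \<Delta> (c i)"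
  have l: "tensor_map A A \<Delta> (\<lambda>b. b) (\<Delta> a) = ?l" and r: "tensor_map A A (\<lambda>b. b) \<Delta> (\<Delta> a) = ?r"
    unfolding \<Delta>a
    by (rule tensor_map_sum[OF subspace subspace, where \<sigma> = "\<lambda>c. c"];
        simp add: \<Delta>_add \<Delta>_scale bc)+
  have "?l = reassoc ?r"
  proof (rule AAA_eqI)
    show "?l \<in> tensor_space (tensor_space A A) A"
      using bc by (intro tensor_space_sum_mem) (auto intro: \<Delta>_mem)
    have "?r \<in> tensor_space A (tensor_space A A)"
      using bc by (intro tensor_space_sum_mem) (auto intro: \<Delta>_mem)
    then show "reassoc ?r \<in> tensor_space (tensor_space A A) A"
      by (rule reassoc_mem[OF subspace subspace])
    have fin: "b i \<in> fin_supp" "c i \<in> fin_supp" "\<Delta> (b i) \<in> fin_supp" "\<Delta> (c i) \<in> fin_supp" if "i < m" for i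
      using bc that A_fin_supp AA_fin_supp \<Delta>_mem by blast+
    fix fs p p' gs q q' hs r r'
    assume f: "rep_index fs p p'" and g: "rep_index gs q q'" and h: "rep_index hs r r'"
    have ne: "q \<noteq> []" "q' \<noteq> []" using g paths_nonempty by blast+
    let ?fg = "last p = hd q \<and> last p' = hd q'" and ?gh = "last q = hd r \<and> last q' = hd r'"
    have \<Delta>a_eval: "lin_ext (\<theta> \<otimes>\<^sub>v \<psi>) (\<Delta> a) = (\<Sum>i<m. lin_ext \<theta> (b i) * lin_ext \<psi> (c i))" for \<theta> \<psi>
      unfolding \<Delta>a by (rule lin_ext_sum_tensor) (use fin in auto)
    have "lin_ext ((T fs p p' \<otimes>\<^sub>v T gs q q') \<otimes>\<^sub>v T hs r r') ?l =
        (\<Sum>i<m. lin_ext (T fs p p' \<otimes>\<^sub>v T gs q q') (\<Delta> (b i)) * lin_ext (T hs r r') (c i))"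
      by (rule lin_ext_sum_tensor) (use fin in auto)
    also have "\<dots> = (\<Sum>i<m. if ?fg then lin_ext (T (fs @ gs) (p \<star> q) (p' \<star> q')) (b i) * lin_ext (T hs r r') (c i) else 0)"
      by (intro sum.cong refl) (simp add: \<Delta>_eval[OF f g] bc)
    also have "\<dots> = (if ?fg then lin_ext (T (fs @ gs) (p \<star> q) (p' \<star> q') \<otimes>\<^sub>v T hs r r') (\<Delta> a) else 0)"
      by (cases ?fg) (simp_all only: \<Delta>a_eval if_True if_False sum.neutral_const simp_thms)
    \<comment> \<open>The junction between \<open>p \<star> q\<close> and \<open>r\<close> is that
      between \<open>q\<close> and \<open>r\<close>, so the conditions do not depend on the
      bracketing.\<close>
    also have "\<dots> = (if ?fg \<and> ?gh then lin_ext (T (fs @ gs @ hs) (p \<star> q \<star> r) (p' \<star> q' \<star> r')) a else 0)"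
    proof (cases ?fg)
      case True
      then show ?thesis
        using \<Delta>_eval[OF rep_index_append[OF f g] h a] ne
        by (simp add: last_concat_path concat_path_assoc)
    qed auto
    also have "\<dots> = (if ?gh then lin_ext (T fs p p' \<otimes>\<^sub>v T (gs @ hs) (q \<star> r) (q' \<star> r')) (\<Delta> a) else 0)"
    proof (cases ?gh)
      case True
      then show ?thesis
        using \<Delta>_eval[OF f rep_index_append[OF g h] a] ne
        by (simp add: hd_concat_path)
    qed auto
    also have "\<dots> = (\<Sum>i<m. if ?gh then lin_ext (T fs p p') (b i) * lin_ext (T (gs @ hs) (q \<star> r) (q' \<star> r')) (c i) else 0)"
      by (cases ?gh) (simp_all only: \<Delta>a_eval if_True if_False sum.neutral_const simp_thms)
    also have "\<dots> = (\<Sum>i<m. lin_ext (T fs p p') (b i) * lin_ext (T gs q q' \<otimes>\<^sub>v T hs r r') (\<Delta> (c i)))"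
      by (intro sum.cong refl) (simp add: \<Delta>_eval[OF g h] bc)
    also have "\<dots> = lin_ext ((T fs p p' \<otimes>\<^sub>v T gs q q') \<otimes>\<^sub>v T hs r r') (reassoc ?r)"
      unfolding lin_ext_reassoc by (rule lin_ext_sum_tensor[symmetric]) (use fin in auto)
    finally show "lin_ext ((T fs p p' \<otimes>\<^sub>v T gs q q') \<otimes>\<^sub>v T hs r r') ?l =
        lin_ext ((T fs p p' \<otimes>\<^sub>v T gs q q') \<otimes>\<^sub>v T hs r r') (reassoc ?r)" .
  qed
  then show ?thesis by (simp only: l r)
qed

section \<open>Compatibility of the coproduct with product and star\<close>

lemma tensor_coeff_mult:
  assumes "rep_index fs p p'" "a \<in> A" "b \<in> A"
  shows "lin_ext (T fs p p') (mul a b) =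
    (\<Sum>r\<in>paths adj (length fs). lin_ext (T fs p r) a * lin_ext (T fs r p') b)"
  using tensor_star_rep[of fs] assms by (simp add: matrix_star_rep_def matrix_rep_def)

lemma tensor_coeff_star:
  assumes "rep_index fs p p'" "a \<in> A"
  shows "lin_ext (T fs p p') (star a) = cnj (lin_ext (T fs p' p) a)"
  using tensor_star_rep[of fs] assms by (simp add: matrix_star_rep_def)

text \<open>The outer lift is balanced only once the inner one has been evaluated, so the inner one
  is computed first.\<close>

lemma tensor_mult_sum:
  assumes "\<And>i. i < m \<Longrightarrow> a i \<in> A" "\<And>i. i < m \<Longrightarrow> b i \<in> A"
    "\<And>j. j < n \<Longrightarrow> c j \<in> A" "\<And>j. j < n \<Longrightarrow> d j \<in> A"
  shows "tensor_mult A mul (\<Sum>i<m::nat. a i \<otimes>\<^sub>v b i) (\<Sum>j<n::nat. c j \<otimes>\<^sub>v d j) =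
    (\<Sum>i<m. \<Sum>j<n. mul (a i) (c j) \<otimes>\<^sub>v mul (b i) (d j))"
proof -
  note l = clinear_onD(2,3)[OF mult_linear_left] and r = clinear_onD(2,3)[OF mult_linear_right]
  have inner: "tensor_lift A A (\<lambda>c d. mul a c \<otimes>\<^sub>v mul b d) (\<Sum>j<n. c j \<otimes>\<^sub>v d j) =
      (\<Sum>j<n. mul a (c j) \<otimes>\<^sub>v mul b (d j))" if "a \<in> A" "b \<in> A" for a b
    by (rule tensor_lift_sum[OF subspace subspace])
      (use assms that in \<open>simp_all add: r tensor_add_left tensor_add_right tensor_scale_left
        tensor_scale_right\<close>)
  let ?B = "\<lambda>a b. tensor_lift A A (\<lambda>c d. mul a c \<otimes>\<^sub>v mul b d) (\<Sum>j<n. c j \<otimes>\<^sub>v d j)"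
  have "tensor_lift A A ?B (\<Sum>i<m. a i \<otimes>\<^sub>v b i) = (\<Sum>i<m. ?B (a i) (b i))"
    by (rule tensor_lift_sum[OF subspace subspace])
      (use assms subspace in \<open>simp_all add: inner cvec.subspace_add cvec.subspace_scale l
        tensor_add_left tensor_add_right tensor_scale_left tensor_scale_right sum.distrib\<close>)
  then show ?thesis using assms by (simp add: tensor_mult_def inner)
qed

text \<open>The product in A \<otimes> A sums over all pairs of inner indices, that of the appended
  representation only over composable ones. The zeros in \<open>\<Delta>_eval\<close> account for
  the difference.\<close>

lemma \<Delta>_mult:
  assumes a: "a \<in> A" and b: "b \<in> A"
  shows "\<Delta> (mul a b) = tensor_mult A mul (\<Delta> a) (\<Delta> b)"
proof -
  obtain m u v where uv: "\<And>i. i < m \<Longrightarrow> u i \<in> A" "\<And>i. i < m \<Longrightarrow> v i \<in> A"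
    and \<Delta>a: "\<Delta> a = (\<Sum>i<m::nat. u i \<otimes>\<^sub>v v i)"
    using \<Delta>_sumE[OF a] by blast
  obtain n w z where wz: "\<And>j. j < n \<Longrightarrow> w j \<in> A" "\<And>j. j < n \<Longrightarrow> z j \<in> A"
    and \<Delta>b: "\<Delta> b = (\<Sum>j<n::nat. w j \<otimes>\<^sub>v z j)"
    using \<Delta>_sumE[OF b] by blast
  let ?t = "\<Sum>i<m. \<Sum>j<n. mul (u i) (w j) \<otimes>\<^sub>v mul (v i) (z j)"
  have "\<Delta> (mul a b) = ?t"
  proof (rule AA_eqI)
    show "\<Delta> (mul a b) \<in> tensor_space A A" using a b by (intro \<Delta>_mem mult_closed)
    show "?t \<in> tensor_space A A"
      using uv wz
      by (intro cvec.subspace_sum[OF subspace_tensor_space] tensor_mem mult_closed) auto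
    have fin: "u i \<in> fin_supp" "v i \<in> fin_supp" if "i < m" for i
      using uv that A_fin_supp by blast+
    have fin': "w j \<in> fin_supp" "z j \<in> fin_supp" if "j < n" for j
      using wz that A_fin_supp by blast+
    have fin'': "mul (u i) (w j) \<in> fin_supp" "mul (v i) (z j) \<in> fin_supp" if "i < m" "j < n" for i j
      using uv wz that A_fin_supp mult_closed by blast+
    fix fs p p' gs q q'
    assume f: "rep_index fs p p'" and g: "rep_index gs q q'"
    let ?f = "paths adj (length fs)" and ?g = "paths adj (length gs)"
    have f': "rep_index fs p s" "rep_index fs s p'" if "s \<in> ?f" for s using f that by auto
    have g': "rep_index gs q s" "rep_index gs s q'" if "s \<in> ?g" for s using g that by auto
    have eval: "lin_ext (\<theta> \<otimes>\<^sub>v \<psi>) (\<Delta> a) = (\<Sum>i<m. lin_ext \<theta> (u i) * lin_ext \<psi> (v i))"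
      "lin_ext (\<theta> \<otimes>\<^sub>v \<psi>) (\<Delta> b) = (\<Sum>j<n. lin_ext \<theta> (w j) * lin_ext \<psi> (z j))" for \<theta> \<psi>
      unfolding \<Delta>a \<Delta>b by (rule lin_ext_sum_tensor; use fin fin' in auto)+
    have "lin_ext (T fs p p' \<otimes>\<^sub>v T gs q q') ?t =
        (\<Sum>i<m. lin_ext (T fs p p' \<otimes>\<^sub>v T gs q q') (\<Sum>j<n. mul (u i) (w j) \<otimes>\<^sub>v mul (v i) (z j)))"
      by (rule lin_ext_sum) (use uv wz in \<open>auto intro!: AA_fin_supp tensor_space_sum_mem mult_closed\<close>)
    also have "\<dots> = (\<Sum>i<m. \<Sum>j<n. lin_ext (T fs p p') (mul (u i) (w j)) * lin_ext (T gs q q') (mul (v i) (z j)))"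
      by (intro sum.cong refl lin_ext_sum_tensor) (use fin'' in auto)
    also have "\<dots> = (\<Sum>i<m. \<Sum>j<n. \<Sum>s\<in>?f. \<Sum>s'\<in>?g.
        (lin_ext (T fs p s) (u i) * lin_ext (T gs q s') (v i)) *
        (lin_ext (T fs s p') (w j) * lin_ext (T gs s' q') (z j)))"
      by (intro sum.cong refl)
        (simp add: uv wz tensor_coeff_mult[OF f] tensor_coeff_mult[OF g] sum_product mult_ac)
    \<comment> \<open>Bundling into pairs allows all four sums to be exchanged by one
      \<open>sum.swap\<close>.\<close>
    also have "\<dots> = (\<Sum>(i, j)\<in>{..<m} \<times> {..<n}. \<Sum>(s, s')\<in>?f \<times> ?g.
        (lin_ext (T fs p s) (u i) * lin_ext (T gs q s') (v i)) *
        (lin_ext (T fs s p') (w j) * lin_ext (T gs s' q') (z j)))"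
      by (simp only: sum.cartesian_product[symmetric])
    also have "\<dots> = (\<Sum>(s, s')\<in>?f \<times> ?g. \<Sum>(i, j)\<in>{..<m} \<times> {..<n}.
        (lin_ext (T fs p s) (u i) * lin_ext (T gs q s') (v i)) *
        (lin_ext (T fs s p') (w j) * lin_ext (T gs s' q') (z j)))"
      unfolding case_prod_unfold by (rule sum.swap)
    also have "\<dots> = (\<Sum>s\<in>?f. \<Sum>s'\<in>?g. \<Sum>i<m. \<Sum>j<n.
        (lin_ext (T fs p s) (u i) * lin_ext (T gs q s') (v i)) *
        (lin_ext (T fs s p') (w j) * lin_ext (T gs s' q') (z j)))"
      by (simp only: sum.cartesian_product[symmetric])
    also have "\<dots> = (\<Sum>s\<in>?f. \<Sum>s'\<in>?g.
        lin_ext (T fs p s \<otimes>\<^sub>v T gs q s') (\<Delta> a) * lin_ext (T fs s p' \<otimes>\<^sub>v T gs s' q') (\<Delta> b))"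
      by (simp only: eval sum_product)
    \<comment> \<open>Each evaluation of \<Delta> imposes one outer and the inner junction; together
      they leave the pattern of \<open>sum_paths_add\<close>.\<close>
    also have "\<dots> = (\<Sum>s\<in>?f. \<Sum>s'\<in>?g. if last s = hd s' then
        (if last p = hd q \<and> last p' = hd q' then lin_ext (T (fs @ gs) (p \<star> q) (s \<star> s')) a *
          lin_ext (T (fs @ gs) (s \<star> s') (p' \<star> q')) b else 0) else 0)"
      using f' g' by (intro sum.cong refl) (simp add: \<Delta>_eval a b)
    also have "\<dots> = (\<Sum>r\<in>paths adj (length fs + length gs). if last p = hd q \<and> last p' = hd q' then
        lin_ext (T (fs @ gs) (p \<star> q) r) a * lin_ext (T (fs @ gs) r (p' \<star> q')) b else 0)"
      unfolding sum_paths_add ..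
    also have "\<dots> = lin_ext (T fs p p' \<otimes>\<^sub>v T gs q q') (\<Delta> (mul a b))"
    proof (cases "last p = hd q \<and> last p' = hd q'")
      case True
      then have "rep_index (fs @ gs) (p \<star> q) (p' \<star> q')" using rep_index_append[OF f g] by blast
      then show ?thesis
        using True a b by (simp add: \<Delta>_eval[OF f g] mult_closed tensor_coeff_mult)
    next
      case False
      then show ?thesis using a b by (auto simp: \<Delta>_eval[OF f g] mult_closed intro!: sum.neutral)
    qed
    finally show "lin_ext (T fs p p' \<otimes>\<^sub>v T gs q q') (\<Delta> (mul a b)) =
      lin_ext (T fs p p' \<otimes>\<^sub>v T gs q q') ?t" ..
  qed
  then show ?thesis using uv wz by (simp add: \<Delta>a \<Delta>b tensor_mult_sum)
qed

text \<open>The star transposes matrix indices, and the composability condition is symmetric under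
  exchanging primed and unprimed ones.\<close>

lemma \<Delta>_star:
  assumes a: "a \<in> A"
  shows "\<Delta> (star a) = tensor_map A A star star (\<Delta> a)"
proof -
  obtain m u v where uv: "\<And>i. i < m \<Longrightarrow> u i \<in> A" "\<And>i. i < m \<Longrightarrow> v i \<in> A"
    and \<Delta>a: "\<Delta> a = (\<Sum>i<m::nat. u i \<otimes>\<^sub>v v i)"
    using \<Delta>_sumE[OF a] by blast
  let ?t = "\<Sum>i<m. star (u i) \<otimes>\<^sub>v star (v i)"
  have t: "tensor_map A A star star (\<Delta> a) = ?t"
    unfolding \<Delta>a
    by (rule tensor_map_sum[OF subspace subspace, where \<sigma> = cnj])
      (simp_all add: star_add star_scale uv)
  have "\<Delta> (star a) = ?t"
  proof (rule AA_eqI)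
    show "\<Delta> (star a) \<in> tensor_space A A" using a by (intro \<Delta>_mem star_closed)
    show "?t \<in> tensor_space A A"
      using uv by (intro tensor_space_sum_mem) (auto intro: star_closed)
    have fin: "u i \<in> fin_supp" "v i \<in> fin_supp" "star (u i) \<in> fin_supp" "star (v i) \<in> fin_supp"
      if "i < m" for i
      using uv that A_fin_supp star_closed by blast+
    fix fs p p' gs q q'
    assume f: "rep_index fs p p'" and g: "rep_index gs q q'"
    have f': "rep_index fs p' p" and g': "rep_index gs q' q" using f g by auto
    have "lin_ext (T fs p p' \<otimes>\<^sub>v T gs q q') (\<Delta> (star a)) =
        cnj (lin_ext (T fs p' p \<otimes>\<^sub>v T gs q' q) (\<Delta> a))"
    proof (cases "last p = hd q \<and> last p' = hd q'")
      case True
      then have "rep_index (fs @ gs) (p \<star> q) (p' \<star> q')" using rep_index_append[OF f g] by blast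
      then show ?thesis
        using True a by (simp add: \<Delta>_eval[OF f g] \<Delta>_eval[OF f' g'] star_closed tensor_coeff_star)
    next
      case False
      then show ?thesis using a by (auto simp: \<Delta>_eval[OF f g] \<Delta>_eval[OF f' g'] star_closed)
    qed
    also have "lin_ext (T fs p' p \<otimes>\<^sub>v T gs q' q) (\<Delta> a) =
        (\<Sum>i<m. lin_ext (T fs p' p) (u i) * lin_ext (T gs q' q) (v i))"
      unfolding \<Delta>a by (rule lin_ext_sum_tensor) (use fin in auto)
    also have "cnj \<dots> = (\<Sum>i<m. lin_ext (T fs p p') (star (u i)) * lin_ext (T gs q q') (star (v i)))"
      unfolding cnj_sum
      by (intro sum.cong refl) (simp add: uv tensor_coeff_star[OF f] tensor_coeff_star[OF g])
    also have "\<dots> = lin_ext (T fs p p' \<otimes>\<^sub>v T gs q q') ?t"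
      by (rule lin_ext_sum_tensor[symmetric]) (use fin in auto)
    finally show "lin_ext (T fs p p' \<otimes>\<^sub>v T gs q q') (\<Delta> (star a)) =
      lin_ext (T fs p p' \<otimes>\<^sub>v T gs q q') ?t" .
  qed
  then show ?thesis by (simp add: t)
qed

lemma \<Delta>_fundamental:
  assumes "f \<in> F" "f' \<in> F" "\<alpha> \<in> edges adj" "\<alpha>' \<in> edges adj" "\<beta> \<in> edges adj" "\<beta>' \<in> edges adj"
    and comp: "last \<alpha> = hd \<beta>" "last \<alpha>' = hd \<beta>'"
    and \<xi>: "\<xi> \<in> essential adj \<mu> n" "\<xi>' \<in> essential adj \<mu> n"
  shows "lin_ext (\<phi> f \<alpha> \<alpha>' \<otimes>\<^sub>v \<phi> f' \<beta> \<beta>') (\<Delta> (\<xi> \<otimes>\<^sub>v \<xi>')) =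
      (\<Sum>\<zeta>\<in>paths adj n. lin_ext (\<phi> f \<alpha> \<alpha>') (\<xi> \<otimes>\<^sub>v basis_vec \<zeta>) * lin_ext (\<phi> f' \<beta> \<beta>') (basis_vec \<zeta> \<otimes>\<^sub>v \<xi>'))"
    and "(\<Sum>\<zeta>\<in>paths adj n. lin_ext (\<phi> f \<alpha> \<alpha>') (\<xi> \<otimes>\<^sub>v basis_vec \<zeta>) * lin_ext (\<phi> f' \<beta> \<beta>') (basis_vec \<zeta> \<otimes>\<^sub>v \<xi>')) =
      lin_ext (T [f, f'] (\<alpha> \<star> \<beta>) (\<alpha>' \<star> \<beta>')) (\<xi> \<otimes>\<^sub>v \<xi>')"
proof -
  \<comment> \<open>The clause for singletons carries a bipath argument; as an equation of functions
    it can be rewritten under \<open>lin_ext\<close> and \<open>\<otimes>\<^sub>v\<close>.\<close>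
  have T1: "T [h] p p' = \<phi> h p p'" for h p p' by (rule ext) simp
  have i: "rep_index [f] \<alpha> \<alpha>'" "rep_index [f'] \<beta> \<beta>'" using assms by auto
  have P: "\<xi> \<in> path_space adj n" "\<xi>' \<in> path_space adj n"
    using \<xi> essential_path_space by blast+
  show "lin_ext (\<phi> f \<alpha> \<alpha>' \<otimes>\<^sub>v \<phi> f' \<beta> \<beta>') (\<Delta> (\<xi> \<otimes>\<^sub>v \<xi>')) =
      (\<Sum>\<zeta>\<in>paths adj n. lin_ext (\<phi> f \<alpha> \<alpha>') (\<xi> \<otimes>\<^sub>v basis_vec \<zeta>) * lin_ext (\<phi> f' \<beta> \<beta>') (basis_vec \<zeta> \<otimes>\<^sub>v \<xi>'))"
    using \<Delta>_essential_eval[OF i \<xi>] by (simp only: T1)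
  show "(\<Sum>\<zeta>\<in>paths adj n. lin_ext (\<phi> f \<alpha> \<alpha>') (\<xi> \<otimes>\<^sub>v basis_vec \<zeta>) * lin_ext (\<phi> f' \<beta> \<beta>') (basis_vec \<zeta> \<otimes>\<^sub>v \<xi>')) =
      lin_ext (T [f, f'] (\<alpha> \<star> \<beta>) (\<alpha>' \<star> \<beta>')) (\<xi> \<otimes>\<^sub>v \<xi>')"
    using sum_tensor_coeff[of "[f]" \<alpha> \<alpha>' "[f']" \<beta> \<beta>', OF _ _ _ _ _ _ _ _ P] i comp
    by (simp only: T1 append_Cons append_Nil) simp
qed

end

theorem proposition4p2:
  fixes adj :: "'v::finite \<Rightarrow> 'v \<Rightarrow> bool"
    and \<mu> :: "real^'v"
    and mul :: "'v bipath cvec \<Rightarrow> 'v bipath cvec \<Rightarrow> 'v bipath cvec"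
    and one :: "'v bipath cvec"
    and star :: "'v bipath cvec \<Rightarrow> 'v bipath cvec"
    and F :: "'f set"
    and \<phi> :: "'f \<Rightarrow> 'v list \<Rightarrow> 'v list \<Rightarrow> 'v bipath \<Rightarrow> complex"
    and A :: "'v bipath cvec set"
    and X :: "'x set"
    and I :: "'x \<Rightarrow> 'i set"
    and R :: "'x \<Rightarrow> ('i, 'v bipath) coeffs"
    and E :: "'x \<Rightarrow> 'i \<Rightarrow> 'i \<Rightarrow> 'v bipath cvec"
    and \<Delta> :: "'v bipath cvec \<Rightarrow> ('v bipath \<times> 'v bipath) cvec"
  assumes "ADE_graph adj"
    and "perron_frobenius_vector adj \<mu>"
    and "double_triangle_algebra adj \<mu> mul one star F \<phi>"
    and "A = EndE adj \<mu>"
    and "irrep_system A mul one star X I R"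
    and "matrix_units A X I R E"
    and "clinear_on A (tensor_space A A) \<Delta>"
    and "\<And>n \<xi> \<xi>'. \<lbrakk>\<xi> \<in> essential adj \<mu> n; \<xi>' \<in> essential adj \<mu> n\<rbrakk> \<Longrightarrow>
      \<Delta> (\<xi> \<otimes>\<^sub>v \<xi>') = (\<Sum>\<zeta>\<in>paths adj n.
        essential_part X I R E (\<xi> \<otimes>\<^sub>v basis_vec \<zeta>) \<otimes>\<^sub>v essential_part X I R E (basis_vec \<zeta> \<otimes>\<^sub>v \<xi>'))"
  shows
    "(\<forall>f\<in>F. \<forall>f'\<in>F. \<forall>\<alpha>\<in>edges adj. \<forall>\<alpha>'\<in>edges adj. \<forall>\<beta>\<in>edges adj. \<forall>\<beta>'\<in>edges adj.
        last \<alpha> = hd \<beta> \<longrightarrow> last \<alpha>' = hd \<beta>' \<longrightarrow>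
        (\<forall>n. \<forall>\<xi>\<in>essential adj \<mu> n. \<forall>\<xi>'\<in>essential adj \<mu> n.
          lin_ext (\<phi> f \<alpha> \<alpha>' \<otimes>\<^sub>v \<phi> f' \<beta> \<beta>') (\<Delta> (\<xi> \<otimes>\<^sub>v \<xi>')) =
            (\<Sum>\<zeta>\<in>paths adj n. lin_ext (\<phi> f \<alpha> \<alpha>') (\<xi> \<otimes>\<^sub>v basis_vec \<zeta>)
                               * lin_ext (\<phi> f' \<beta> \<beta>') (basis_vec \<zeta> \<otimes>\<^sub>v \<xi>')) \<and>
          (\<Sum>\<zeta>\<in>paths adj n. lin_ext (\<phi> f \<alpha> \<alpha>') (\<xi> \<otimes>\<^sub>v basis_vec \<zeta>)
                             * lin_ext (\<phi> f' \<beta> \<beta>') (basis_vec \<zeta> \<otimes>\<^sub>v \<xi>')) =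
            lin_ext (tensor_coeff adj \<phi> [f, f'] (\<alpha> \<star> \<beta>) (\<alpha>' \<star> \<beta>')) (\<xi> \<otimes>\<^sub>v \<xi>')))
    \<and> (\<forall>a\<in>A. tensor_map A A \<Delta> (\<lambda>b. b) (\<Delta> a) = reassoc (tensor_map A A (\<lambda>b. b) \<Delta> (\<Delta> a)))
    \<and> (\<forall>a\<in>A. \<forall>b\<in>A. \<Delta> (mul a b) = tensor_mult A mul (\<Delta> a) (\<Delta> b))
    \<and> (\<forall>n. \<forall>\<xi>\<in>essential adj \<mu> n. \<forall>\<xi>'\<in>essential adj \<mu> n.
        \<Delta> (star (\<xi> \<otimes>\<^sub>v \<xi>')) = tensor_map A A star star (\<Delta> (\<xi> \<otimes>\<^sub>v \<xi>')))"
proof -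
  interpret double_triangle_algebra adj \<mu> mul one star F \<phi> by (rule assms(3))
  interpret irrep_system "EndE adj \<mu>" mul one star X I R using assms(5) by (simp only: assms(4))
  interpret dta_coproduct adj \<mu> mul one star F \<phi> X I R E \<Delta>
    using assms(6-8) by unfold_locales (simp_all only: assms(4))
  have star: "\<Delta> (star (\<xi> \<otimes>\<^sub>v \<xi>')) = tensor_map A A star star (\<Delta> (\<xi> \<otimes>\<^sub>v \<xi>'))"
    if "\<xi> \<in> essential adj \<mu> n" "\<xi>' \<in> essential adj \<mu> n" for n \<xi> \<xi>'
    using \<Delta>_star[OF EndE_tensor_mem[OF that]] by (simp only: assms(4))
  show ?thesis
    unfolding assms(4)
    by (intro conjI ballI allI impI \<Delta>_fundamental \<Delta>_coassoc \<Delta>_mult star[unfolded assms(4)])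
qed

end
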